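(* Let $\mathcal{A}=\{\mathcal{H}_m : m\in\mathbb{N}\}$ be a family of distinct hypergraphs and set $n=n(m)=|V(\mathcal{H}_m)|$. Let $r=r(n)\geq 2$, $t=t(n)$, $d=d(n)$ and $q=q(n)$ be integer functions with $(d-1)(t-1)+1\leq q\leq (d-1)t$, and let $\rho=\rho(n)\in(0,1]$ be a real function. If $$n\ln(r+1)+rt\bigl(1+\ln(d-1)\bigr)-\rho t^r\longrightarrow -\infty \quad\text{as } n\to\infty,$$ then almost surely $$\chi\bigl(\operatorname{KG}^r(\mathcal{H}_m)(\rho)\bigr)\geq \min\left\{\frac{|V(\mathcal{H}_m)|-\operatorname{alt}_r(\mathcal{H}_m,q)}{r-1},\, d\right\}.$$
   Context: A hypergraph $\mathcal{H}$ consists of a finite nonempty vertex set $V(\mathcal{H})$ and a family $E(\mathcal{H})$ of distinct nonempty subsets of $V(\mathcal{H})$ (edges). For $S\subseteq V(\mathcal{H})$, $\mathcal{H}[S]$ denotes the induced subhypergraph with vertex set $S$ whose edges are the edges of $\mathcal{H}$ contained in $S$. The chromatic number $\chi$ of a hypergraph is the least number of colors in a coloring of its vertices with no edge all of whose vertices receive the same color. For $r\geq 2$, the general Kneser hypergraph $\operatorname{KG}^r(\mathcal{H})$ has vertex set $E(\mathcal{H})$, and $\{e_1,\dots,e_r\}\subseteq E(\mathcal{H})$ is an edge iff $e_1,\dots,e_r$ are pairwise disjoint. For $\rho\in(0,1]$, the random hypergraph $\operatorname{KG}^r(\mathcal{H})(\rho)$ is the spanning subhypergraph of $\operatorname{KG}^r(\mathcal{H})$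 containing each edge of $\operatorname{KG}^r(\mathcal{H})$ independently with probability $\rho$. Alternation number: let $\mathbb{Z}_r=\{\omega^1,\dots,\omega^r\}$ be a cyclic group of order $r$ with generator $\omega$. For $X=(x_1,\dots,x_n)\in(\mathbb{Z}_r\cup\{0\})^n$, an alternating subsequence of $X$ is a sequence $x_{i_1},\dots,x_{i_k}$ ($i_1<\dots<i_k$) of nonzero entries of $X$ with $x_{i_j}\neq x_{i_{j+1}}$ for all $j\in[k-1]$; $\operatorname{alt}(X)$ is the maximum length of such a subsequence, with $\operatorname{alt}(0,\dots,0)=0$. For $i\in[r]$ let $X^i=\{j\in[n]: x_j=\omega^i\}$. For a hypergraph $\mathcal{H}$ with $|V(\mathcal{H})|=n$, a bijection $\sigma:[n]\to V(\mathcal{H})$ and a positive integer $q$, define $\operatorname{alt}_r(\mathcal{H},\sigma,q)=\max\{\operatorname{alt}(X): X\in(\mathbb{Z}_r\cup\{0\})^n,\ |E(\mathcal{H}[\sigma(X^i)])|\leq q-1 \text{ for all } i\in[r]\}$, and $\operatorname{alt}_r(\mathcal{H},q)=\min_\sigma \operatorname{alt}_r(\mathcal{H},\sigma,q)$ over all bijections $\sigma:[n]\to V(\mathcal{H})$. "Almost surely" means with probability tending to $1$ as $n\to\infty$. *)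

theory Defs
  imports "HOL-Probability.Product_PMF" "HOL-Library.Sublist"
begin

type_synonym 'a hypergraph = "'a set \<times> 'a set set"

abbreviation verts :: "'a hypergraph \<Rightarrow> 'a set" where
  "verts H \<equiv> fst H"

abbreviation edges :: "'a hypergraph \<Rightarrow> 'a set set" where
  "edges H \<equiv> snd H"

definition hypergraph :: "'a hypergraph \<Rightarrow> bool" where
  "hypergraph H \<longleftrightarrow> finite (verts H) \<and> verts H \<noteq> {} \<and>
     (\<forall>e\<in>edges H. e \<noteq> {} \<and> e \<subseteq> verts H)"

definition induced :: "'a hypergraph \<Rightarrow> 'a set \<Rightarrow> 'a hypergraph" where
  "induced H S = (S, {e \<in> edges H. e \<subseteq> S})"

definition proper_coloring :: "'a hypergraph \<Rightarrow> nat \<Rightarrow> ('a \<Rightarrow> nat) \<Rightarrow> bool" where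
  "proper_coloring H k c \<longleftrightarrow> c ` verts H \<subseteq> {..<k} \<and>
     (\<forall>e\<in>edges H. \<not> (\<exists>a. \<forall>v\<in>e. c v = a))"

text \<open>Unspecified if \<open>H\<close> has a singleton edge. This does not happen for subhypergraphs of
  \<open>KG r H\<close> below, whose edges have \<open>r \<ge> 2\<close> elements.\<close>

definition chromatic_number :: "'a hypergraph \<Rightarrow> nat" where
  "chromatic_number H = (LEAST k. \<exists>c. proper_coloring H k c)"

definition KG :: "nat \<Rightarrow> 'a hypergraph \<Rightarrow> 'a set hypergraph" where
  "KG r H = (edges H, {F. F \<subseteq> edges H \<and> card F = r \<and> pairwise disjnt F})"

definition random_KG :: "nat \<Rightarrow> 'a hypergraph \<Rightarrow> real \<Rightarrow> 'a set hypergraph pmf" where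
  "random_KG r H \<rho> =
     map_pmf (\<lambda>\<omega>. (verts (KG r H), {F \<in> edges (KG r H). \<omega> F}))
       (Pi_pmf (edges (KG r H)) False (\<lambda>_. bernoulli_pmf \<rho>))"

text \<open>A vector \<open>X\<close> over \<open>\<int>\<^sub>r \<union> {0}\<close> is a list over \<open>{0..r}\<close>, where \<open>i \<in> {1..r}\<close> stands for the
  group element \<open>\<omega>\<^sup>i\<close>; the group operation plays no role in the alternation number. Positions
  are numbered from \<open>0\<close>, so \<open>[n]\<close> becomes \<open>{..<n}\<close>.\<close>

definition alt :: "nat list \<Rightarrow> nat" where
  "alt X = Max {length Y |Y. subseq Y X \<and> 0 \<notin> set Y \<and> distinct_adj Y}"

definition positions :: "nat list \<Rightarrow> nat \<Rightarrow> nat set" where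
  "positions X i = {j. j < length X \<and> X ! j = i}"

definition alt_perm :: "nat \<Rightarrow> 'a hypergraph \<Rightarrow> (nat \<Rightarrow> 'a) \<Rightarrow> int \<Rightarrow> nat" where
  "alt_perm r H \<sigma> q =
     Max {alt X |X. length X = card (verts H) \<and> set X \<subseteq> {0..r} \<and>
       (\<forall>i\<in>{1..r}. int (card (edges (induced H (\<sigma> ` positions X i)))) \<le> q - 1)}"

definition alt_num :: "nat \<Rightarrow> 'a hypergraph \<Rightarrow> int \<Rightarrow> nat" where
  "alt_num r H q =
     Min {alt_perm r H \<sigma> q |\<sigma>. bij_betw \<sigma> {..<card (verts H)} (verts H)}"

end

theory Submission
  imports Defs "HOL-Number_Theory.Cong"
begin

text \<open>
  Select from every vertex set \<open>A\<close> spanning at least \<open>q\<close> edges exactly \<open>q\<close> of them. A coloring of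
  the Kneser hypergraph with fewer than \<open>d\<close> colors uses some color at least \<open>t\<close> times on each
  selection, and this colors the sets \<open>A\<close> themselves. If the number of colors is also less than
  \<open>(n - alt) / (r - 1)\<close>, then the deterministic bound of Alishahi and Hajiabolhassan, applied to
  the hypergraph of the sets \<open>A\<close>, gives \<open>r\<close> disjoint sets of the same color, hence \<open>r\<close>
  monochromatic families of \<open>t\<close> edges all of whose \<open>t\<^sup>r\<close> transversals are missing from the random
  hypergraph. There are at most \<open>(r + 1)\<^sup>n\<close> choices of the sets and \<open>(q choose t)\<^sup>r\<close> of the
  families, so a union bound finishes the proof.

  For prime \<open>r = p\<close> the deterministic bound rests on a combinatorial form of Dold's theorem: an
  equivariant labelling of the nonzero vectors of \<open>(\<int>\<^sub>p \<union> {0})\<^sup>n\<close> by \<open>\<int>\<^sub>p\<close> has a chain of \<open>n\<close>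
  vectors with distinct consecutive labels. This is because a generator of the cohomology of \<open>\<int>\<^sub>p\<close>
  in degree \<open>n - 1\<close>, pulled back along the labelling, takes the value \<open>1\<close> modulo \<open>p\<close> on an
  explicit chain of the order complex. A vector is labelled by its first nonzero entry if its
  alternation is small, and by the classes containing an edge of the least available color
  otherwise. Composite \<open>r\<close> reduce to their factors.
\<close>

section \<open>Cochains on lists\<close>

fun coboundary :: "('a list \<Rightarrow> int) \<Rightarrow> 'a list \<Rightarrow> int" where
  "coboundary f [] = 0"
| "coboundary f (x # c) = f c - coboundary (\<lambda>c'. f (x # c')) c"

text \<open>Dual of inserting \<open>g y\<close> in all possible ways into a chain \<open>c\<close> lying above \<open>y\<close>; with \<open>g\<close> adding
  a vertex, this contracts chains onto that vertex.\<close>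

fun prism :: "('a \<Rightarrow> 'a) \<Rightarrow> 'a \<Rightarrow> ('a list \<Rightarrow> int) \<Rightarrow> 'a list \<Rightarrow> int" where
  "prism g y f [] = f [g y]"
| "prism g y f (x # c) = f (g y # g x # map g c) - prism g x (\<lambda>c'. f (x # c')) c"

text \<open>Alternately the operators \<open>w - 1\<close> and \<open>1 + w + \<dots> + w\<^bsup>p-1\<^esup>\<close> of the periodic resolution of
  a cyclic group; \<open>k = 0\<close> is the augmentation.\<close>

definition periodic_diff :: "('a \<Rightarrow> 'a) \<Rightarrow> nat \<Rightarrow> nat \<Rightarrow> ('a list \<Rightarrow> int) \<Rightarrow> 'a list \<Rightarrow> int" where
  "periodic_diff w p k f c =
     (if k = 0 then f c else if odd k then f (map w c) - f c
      else (\<Sum>s<p. f (map (w ^^ s) c)))"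

definition normalized_cochain :: "('a list \<Rightarrow> int) \<Rightarrow> bool" where
  "normalized_cochain f \<longleftrightarrow> (\<forall>c. \<not> distinct_adj c \<longrightarrow> f c = 0)"

lemma coboundary_diff:
  "coboundary (\<lambda>c. f c - g c) c = coboundary f c - coboundary g c"
  by (induction c arbitrary: f g) auto

lemma coboundary_zero: "coboundary (\<lambda>c. 0) c = 0"
  by (induction c) auto

lemma coboundary_sum:
  "coboundary (\<lambda>c. \<Sum>s\<in>A. f s c) c = (\<Sum>s\<in>A. coboundary (f s) c)"
  by (induction c arbitrary: f) (auto simp: sum_subtractf)

lemma coboundary_map:
  "coboundary (\<lambda>c. f (map g c)) c = coboundary f (map g c)"
  by (induction c arbitrary: f) auto

lemma coboundary_coboundary: "coboundary (coboundary f) c = 0"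
  by (induction c arbitrary: f) (auto simp: coboundary_diff)

lemma coboundary_cong_mod:
  assumes "\<And>c'. set c' \<subseteq> set c \<Longrightarrow> Suc (length c') = length c \<Longrightarrow> [f c' = g c'] (mod m)"
  shows "[coboundary f c = coboundary g c] (mod m)"
  using assms
proof (induction c arbitrary: f g)
  case (Cons x c)
  have "[coboundary (\<lambda>c'. f (x # c')) c = coboundary (\<lambda>c'. g (x # c')) c] (mod m)"
    by (rule Cons.IH, rule Cons.prems) auto
  moreover have "[f c = g c] (mod m)"
    by (rule Cons.prems) auto
  ultimately show ?case by (simp add: cong_diff)
qed simp

lemma normalized_cochain_Cons:
  "normalized_cochain f \<Longrightarrow> normalized_cochain (\<lambda>c. f (x # c))"
  unfolding normalized_cochain_def by (metis distinct_adj_ConsD)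

lemma normalized_cochain_coboundary:
  assumes "normalized_cochain f"
  shows "normalized_cochain (coboundary f)"
proof -
  have "coboundary f c = 0" if "\<not> distinct_adj c" for c
    using assms that
  proof (induction c arbitrary: f rule: induct_list012)
    case (3 x y c)
    show ?case
    proof (cases "x = y")
      case True
      then have "(\<lambda>c'. f (x # y # c')) = (\<lambda>_. 0)"
        using "3.prems"(1) by (simp add: normalized_cochain_def)
      then show ?thesis using True by (simp add: coboundary_zero)
    next
      case False
      then have not_distinct: "\<not> distinct_adj (y # c)" using "3.prems"(2) by simp
      then have "coboundary (\<lambda>c'. f (x # c')) (y # c) = 0"
        using "3.prems"(1) by (intro "3.IH"(2) normalized_cochain_Cons)
      moreover have "f (y # c) = 0"
        using not_distinct "3.prems"(1) unfolding normalized_cochain_def by blast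
      ultimately show ?thesis by simp
    qed
  qed auto
  then show ?thesis by (simp add: normalized_cochain_def)
qed

lemma prism_diff:
  "prism g y (\<lambda>c. f c - f' c) c = prism g y f c - prism g y f' c"
  by (induction c arbitrary: f f' y) auto

lemma prism_change_base_point:
  "prism g y f c - prism g x f c = f (g y # map g c) - f (g x # map g c)"
  by (cases c) auto

lemma prism_coboundary:
  "prism g y (coboundary f) c = f c - coboundary (prism g y f) c"
proof (induction c arbitrary: f y)
  case (Cons x c)
  have "coboundary (\<lambda>c'. f (g y # g x # map g c')) c
      = coboundary (\<lambda>c'. f (g y # g x # c')) (map g c)"
    by (rule coboundary_map)
  then show ?case
    using Cons.IH[of x "\<lambda>c'. f (x # c')"] prism_change_base_point[of g y f c x]
    by (simp add: prism_diff coboundary_diff)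
qed simp

lemma prism_cong_mod:
  assumes "\<And>i. i \<le> length c \<Longrightarrow>
    [f (take i c @ map g (drop i (y # c))) = f' (take i c @ map g (drop i (y # c)))] (mod m)"
  shows "[prism g y f c = prism g y f' c] (mod m)"
  using assms
proof (induction c arbitrary: f f' y)
  case (Cons x c)
  have "[prism g x (\<lambda>c'. f (x # c')) c = prism g x (\<lambda>c'. f' (x # c')) c] (mod m)"
  proof (rule Cons.IH)
    fix i assume "i \<le> length c"
    then show "[f (x # take i c @ map g (drop i (x # c)))
        = f' (x # take i c @ map g (drop i (x # c)))] (mod m)"
      using Cons.prems[of "Suc i"] by simp
  qed
  moreover have "[f (g y # g x # map g c) = f' (g y # g x # map g c)] (mod m)"
    using Cons.prems[of 0] by simp
  ultimately show ?case by (simp add: cong_diff)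
qed simp

lemma periodic_diff_eq:
  "periodic_diff w p 0 f = f"
  "odd k \<Longrightarrow> periodic_diff w p k f = (\<lambda>c. f (map w c) - f c)"
  "even k \<Longrightarrow> 0 < k \<Longrightarrow> periodic_diff w p k f = (\<lambda>c. \<Sum>s<p. f (map (w ^^ s) c))"
  by (auto simp: periodic_diff_def fun_eq_iff)

lemma periodic_diff_diff:
  "periodic_diff w p k (\<lambda>c. f c - g c) c = periodic_diff w p k f c - periodic_diff w p k g c"
  by (auto simp: periodic_diff_def sum_subtractf)

lemma coboundary_periodic_diff:
  "coboundary (periodic_diff w p k f) c = periodic_diff w p k (coboundary f) c"
proof -
  consider "k = 0" | "odd k" | "even k" "0 < k" by blast
  then show ?thesis
    by cases (simp_all add: periodic_diff_eq coboundary_diff coboundary_sum coboundary_map)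
qed

lemma periodic_diff_cong_mod:
  assumes "\<And>s. [f (map (w ^^ s) c) = g (map (w ^^ s) c)] (mod m)"
  shows "[periodic_diff w p k f c = periodic_diff w p k g c] (mod m)"
  using assms[of 0] assms[of 1] assms
  by (auto simp: periodic_diff_def intro: cong_diff cong_sum)

lemma sum_orbit_shift:
  fixes f :: "'a list \<Rightarrow> int"
  assumes "w ^^ p = id"
  shows "(\<Sum>s<p. f (map (w ^^ s) (map (w ^^ m) c))) = (\<Sum>s<p. f (map (w ^^ s) c))"
proof (induction m)
  case (Suc m)
  define orbit where "orbit s = f (map (w ^^ s) (map (w ^^ m) c))" for s
  have "(\<Sum>s<p. orbit (Suc s)) - (\<Sum>s<p. orbit s) = orbit p - orbit 0"
    unfolding sum_subtractf[symmetric] by (rule sum_lessThan_telescope)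
  also have "\<dots> = 0" using assms by (simp add: orbit_def)
  finally have "(\<Sum>s<p. orbit (Suc s)) = (\<Sum>s<p. f (map (w ^^ s) c))"
    using Suc.IH by (simp add: orbit_def)
  moreover have "f (map (w ^^ s) (map (w ^^ Suc m) c)) = orbit (Suc s)" for s
    by (simp add: orbit_def funpow_swap1 comp_def)
  ultimately show ?case by (simp only:)
qed simp

lemma periodic_diff_periodic_diff:
  assumes "w ^^ p = id" "k > 0"
  shows "periodic_diff w p k (periodic_diff w p (Suc k) f) c = 0"
proof -
  have shift: "(\<Sum>s<p. f (map (w ^^ s) (map w c))) = (\<Sum>s<p. f (map (w ^^ s) c))"
    using sum_orbit_shift[OF assms(1), of f 1] by simp
  have commute: "map w (map (w ^^ s) c) = map (w ^^ s) (map w c)" for s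
    by (simp add: funpow_swap1)
  show ?thesis
  proof (cases "odd k")
    case True
    then show ?thesis using shift by (simp add: periodic_diff_eq)
  next
    case False
    then have "periodic_diff w p k (periodic_diff w p (Suc k) f) c
        = (\<Sum>s<p. f (map w (map (w ^^ s) c)) - f (map (w ^^ s) c))"
      using assms(2) by (simp add: periodic_diff_eq)
    also have "\<dots> = 0" using shift by (simp only: commute sum_subtractf diff_self)
    finally show ?thesis .
  qed
qed

section \<open>Tuples over a cyclic group\<close>

text \<open>Multiplication by \<open>\<omega>\<close>; values above \<open>p\<close> are fixed so that the \<open>p\<close>-th power is the identity
  on all of \<open>nat\<close>.\<close>

definition rot :: "nat \<Rightarrow> nat \<Rightarrow> nat" where
  "rot p i = (if i = 0 \<or> i > p then i else if i = p then 1 else i + 1)"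

lemma rot_eq_mod: "i \<in> {1..p} \<Longrightarrow> rot p i = i mod p + 1"
  by (cases "i = p") (auto simp: rot_def)

lemma rot_eq_iff: "rot p i = rot p j \<longleftrightarrow> i = j"
  by (auto simp: rot_def split: if_splits)

lemma rot_eq_0_iff [simp]: "rot p i = 0 \<longleftrightarrow> i = 0"
  by (auto simp: rot_def)

lemma rot_in: "i \<in> {1..p} \<Longrightarrow> rot p i \<in> {1..p}"
  by (auto simp: rot_def)

lemma rot_pow_in: "i \<in> {1..p} \<Longrightarrow> (rot p ^^ s) i \<in> {1..p}"
  by (induction s) (auto simp: rot_def)

lemma rot_image: "rot p ` {1..p} = {1..p}"
  by (rule endo_inj_surj) (auto simp: rot_def inj_on_def split: if_splits)

lemma rot_pow_eq_mod:
  assumes "i \<in> {1..p}"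
  shows "(rot p ^^ s) i = (i - 1 + s) mod p + 1"
proof (induction s)
  case (Suc s)
  then show ?case
    using rot_pow_in[OF assms, of s] by (simp add: rot_eq_mod mod_simps)
qed (use assms in auto)

lemma rot_pow_self: "rot p ^^ p = id"
proof
  fix i
  show "(rot p ^^ p) i = id i"
  proof (cases "i \<in> {1..p}")
    case True
    then have "i - 1 < p" by auto
    then have "(i - 1 + p) mod p = i - 1" by (simp only: mod_add_self2 mod_less)
    with True show ?thesis by (simp only: rot_pow_eq_mod) simp
  next
    case False
    then have "rot p i = i" by (auto simp: rot_def)
    then have "(rot p ^^ s) i = i" for s by (induction s) auto
    then show ?thesis by simp
  qed
qed

definition orbit_rep :: "nat \<Rightarrow> nat list \<Rightarrow> nat list" where
  "orbit_rep p c = map (rot p ^^ (Suc p - hd c)) c"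

definition orbit_antidifference :: "nat \<Rightarrow> (nat list \<Rightarrow> int) \<Rightarrow> nat list \<Rightarrow> int" where
  "orbit_antidifference p \<gamma> c = (\<Sum>j<hd c - 1. \<gamma> (map (rot p ^^ j) (orbit_rep p c)))"

definition orbit_section :: "(nat list \<Rightarrow> int) \<Rightarrow> nat list \<Rightarrow> int" where
  "orbit_section \<gamma> c = (if hd c = 1 then \<gamma> c else 0)"

lemma length_orbit_rep [simp]: "length (orbit_rep p c) = length c"
  by (simp add: orbit_rep_def)

lemma set_map_rot_pow_subset: "set c \<subseteq> {1..p} \<Longrightarrow> set (map (rot p ^^ s) c) \<subseteq> {1..p}"
  unfolding set_map by (intro image_subsetI rot_pow_in) (rule subsetD)

lemma set_orbit_rep_subset: "set c \<subseteq> {1..p} \<Longrightarrow> set (orbit_rep p c) \<subseteq> {1..p}"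
  unfolding orbit_rep_def by (rule set_map_rot_pow_subset)

lemma map_rot_pow_add: "map (rot p ^^ i) (map (rot p ^^ j) c) = map (rot p ^^ (i + j)) c"
  by (simp add: funpow_add)

context
  fixes p :: nat and c :: "nat list"
  assumes c: "c \<noteq> []" "set c \<subseteq> {1..p}"
begin

lemma hd_in_range: "hd c \<in> {1..p}"
  using c by (meson hd_in_set subsetD)

lemma hd_orbit_rep: "hd (orbit_rep p c) = 1"
  using hd_in_range c(1) by (simp add: orbit_rep_def hd_map rot_pow_eq_mod)

lemma map_rot_pow_orbit_rep: "map (rot p ^^ (hd c - 1)) (orbit_rep p c) = c"
proof -
  have "hd c - 1 + (Suc p - hd c) = p" using hd_in_range by auto
  then show ?thesis unfolding orbit_rep_def map_rot_pow_add by (simp add: rot_pow_self)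
qed

lemma orbit_rep_map_rot: "orbit_rep p (map (rot p) c) = orbit_rep p c"
proof (cases "hd c = p")
  case True
  then have "rot p (hd c) = 1" using hd_in_range by (auto simp: rot_def)
  with True show ?thesis using c(1) rot_pow_self[of p] by (simp add: orbit_rep_def hd_map)
next
  case False
  then have "rot p (hd c) = Suc (hd c)" "Suc p - hd c = Suc (p - hd c)"
    using hd_in_range by (auto simp: rot_def)
  then show ?thesis using c(1) by (simp add: orbit_rep_def hd_map funpow_swap1 comp_def)
qed

lemma orbit_antidifference_diff:
  assumes "[(\<Sum>s<p. \<gamma> (map (rot p ^^ s) (orbit_rep p c))) = 0] (mod m)"
  shows "[orbit_antidifference p \<gamma> (map (rot p) c) - orbit_antidifference p \<gamma> c = \<gamma> c] (mod m)"
proof -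
  define orbit where "orbit j = \<gamma> (map (rot p ^^ j) (orbit_rep p c))" for j
  have last: "orbit (hd c - 1) = \<gamma> c" by (simp only: orbit_def map_rot_pow_orbit_rep)
  have now: "orbit_antidifference p \<gamma> c = (\<Sum>j<hd c - 1. orbit j)"
    by (simp add: orbit_antidifference_def orbit_def)
  have rotated: "orbit_antidifference p \<gamma> (map (rot p) c) = (\<Sum>j<rot p (hd c) - 1. orbit j)"
    using c(1) by (simp add: orbit_antidifference_def orbit_def orbit_rep_map_rot hd_map)
  obtain i where i: "hd c = Suc i" using hd_in_range by (cases "hd c") auto
  show ?thesis
  proof (cases "hd c = p")
    case True
    then have "rot p (hd c) - 1 = 0" using hd_in_range by (simp add: rot_def)
    moreover have "(\<Sum>j<p. orbit j) = (\<Sum>j<i. orbit j) + \<gamma> c"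
      using last unfolding True[symmetric] i by simp
    then have "[(\<Sum>j<i. orbit j) + \<gamma> c = 0] (mod m)"
      using assms by (simp add: orbit_def)
    ultimately show ?thesis
      using now rotated i by (simp add: cong_iff_dvd_diff dvd_diff_commute add.commute)
  next
    case False
    then have "rot p (hd c) - 1 = Suc i" using hd_in_range i by (simp add: rot_def)
    then show ?thesis using now rotated last i by simp
  qed
qed

lemma sum_orbit_section: "(\<Sum>s<p. orbit_section \<gamma> (map (rot p ^^ s) c)) = \<gamma> (orbit_rep p c)"
proof -
  have "hd (map (rot p ^^ s) (orbit_rep p c)) = 1 \<longleftrightarrow> s = 0" if "s < p" for s
  proof -
    have "orbit_rep p c \<noteq> []" using c(1) by (simp add: orbit_rep_def)
    then have "hd (map (rot p ^^ s) (orbit_rep p c)) = s mod p + 1"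
      using that by (simp add: hd_map hd_orbit_rep rot_pow_eq_mod)
    then show ?thesis using that by simp
  qed
  then have "(\<Sum>s<p. orbit_section \<gamma> (map (rot p ^^ s) (orbit_rep p c)))
      = (\<Sum>s<p. if s = 0 then \<gamma> (map (rot p ^^ s) (orbit_rep p c)) else 0)"
    by (intro sum.cong) (auto simp: orbit_section_def)
  also have "\<dots> = \<gamma> (orbit_rep p c)" using hd_in_range by simp
  finally show ?thesis
    using sum_orbit_shift[OF rot_pow_self, of "orbit_section \<gamma>" p "hd c - 1" "orbit_rep p c"]
    by (simp only: map_rot_pow_orbit_rep)
qed

end

lemma cong_map_rot_pow:
  assumes "\<And>c. length c = k \<Longrightarrow> set c \<subseteq> {1..p} \<Longrightarrow> [\<gamma> (map (rot p) c) - \<gamma> c = 0] (mod (m::int))"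
    and "length c = k" "set c \<subseteq> {1..p}"
  shows "[\<gamma> (map (rot p ^^ s) c) = \<gamma> c] (mod m)"
proof (induction s)
  case (Suc s)
  have "[\<gamma> (map (rot p) (map (rot p ^^ s) c)) - \<gamma> (map (rot p ^^ s) c) = 0] (mod m)"
    using assms(2) set_map_rot_pow_subset[OF assms(3)] by (intro assms(1)) simp_all
  then have "[\<gamma> (map (rot p ^^ Suc s) c) = \<gamma> (map (rot p ^^ s) c)] (mod m)"
    by (simp add: cong_diff_iff_cong_0 comp_def)
  then show ?case using Suc.IH by (rule cong_trans)
qed simp

lemma normalized_orbit_antidifference:
  assumes "normalized_cochain \<gamma>"
  shows "normalized_cochain (orbit_antidifference p \<gamma>)"
  unfolding normalized_cochain_def
proof (intro allI impI)
  fix c :: "nat list" assume "\<not> distinct_adj c"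
  then have "\<not> distinct_adj (map (rot p ^^ j) (orbit_rep p c))" for j
    unfolding orbit_rep_def using distinct_adj_mapD by blast
  then show "orbit_antidifference p \<gamma> c = 0"
    using assms by (simp add: orbit_antidifference_def normalized_cochain_def)
qed

text \<open>The cyclic group acts freely on tuples, so on functions of tuples the kernel of each of the
  operators \<open>w - 1\<close> and \<open>1 + w + \<dots> + w\<^bsup>p-1\<^esup>\<close> is the image of the other.\<close>

lemma periodic_diff_rot_exact:
  assumes "k \<ge> 1" "normalized_cochain \<gamma>"
    and kernel: "\<And>c. length c = k \<Longrightarrow> set c \<subseteq> {1..p} \<Longrightarrow>
               [periodic_diff (rot p) p (Suc k) \<gamma> c = 0] (mod m)"
  obtains \<beta> where "normalized_cochain \<beta>"
    and "\<And>c. length c = k \<Longrightarrow> set c \<subseteq> {1..p} \<Longrightarrow> [periodic_diff (rot p) p k \<beta> c = \<gamma> c] (mod m)"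
proof (cases "odd k")
  case True
  show ?thesis
  proof
    show "normalized_cochain (orbit_antidifference p \<gamma>)"
      using assms(2) by (rule normalized_orbit_antidifference)
    fix c assume c: "length c = k" "set c \<subseteq> {1..p}"
    then have "[periodic_diff (rot p) p (Suc k) \<gamma> (orbit_rep p c) = 0] (mod m)"
      by (intro kernel set_orbit_rep_subset) simp_all
    moreover have "c \<noteq> []" using c(1) \<open>k \<ge> 1\<close> by auto
    ultimately show "[periodic_diff (rot p) p k (orbit_antidifference p \<gamma>) c = \<gamma> c] (mod m)"
      using True c(2) by (simp add: periodic_diff_eq orbit_antidifference_diff)
  qed
next
  case False
  show ?thesis
  proof
    show "normalized_cochain (orbit_section \<gamma>)"
      using assms(2) by (simp add: normalized_cochain_def orbit_section_def)
    fix c assume c: "length c = k" "set c \<subseteq> {1..p}"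
    then have "[\<gamma> (map (rot p) c) - \<gamma> c = 0] (mod m)" if "length c = k" "set c \<subseteq> {1..p}" for c
      using kernel[OF that] False by (simp add: periodic_diff_eq)
    then have "[\<gamma> (orbit_rep p c) = \<gamma> c] (mod m)"
      unfolding orbit_rep_def using c by (rule cong_map_rot_pow)
    moreover have "c \<noteq> []" using c(1) \<open>k \<ge> 1\<close> by auto
    ultimately show "[periodic_diff (rot p) p k (orbit_section \<gamma>) c = \<gamma> c] (mod m)"
      using False c(2) \<open>k \<ge> 1\<close> by (simp add: periodic_diff_eq sum_orbit_section)
  qed
qed

section \<open>Equivariant labellings\<close>

definition nonzero_vectors :: "nat \<Rightarrow> 'v set \<Rightarrow> ('v \<Rightarrow> nat) set" where
  "nonzero_vectors p V = {X. X \<noteq> (\<lambda>_. 0) \<and> (\<forall>i. X i \<le> p) \<and> (\<forall>i. i \<notin> V \<longrightarrow> X i = 0)}"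

definition extends :: "('v \<Rightarrow> nat) \<Rightarrow> ('v \<Rightarrow> nat) \<Rightarrow> bool" where
  "extends X Y \<longleftrightarrow> (\<forall>i. X i \<noteq> 0 \<longrightarrow> Y i = X i)"

definition vector_chain :: "nat \<Rightarrow> 'v set \<Rightarrow> ('v \<Rightarrow> nat) list \<Rightarrow> bool" where
  "vector_chain p V c \<longleftrightarrow> set c \<subseteq> nonzero_vectors p V \<and> sorted_wrt extends c"

definition rotv :: "nat \<Rightarrow> ('v \<Rightarrow> nat) \<Rightarrow> 'v \<Rightarrow> nat" where
  "rotv p X = rot p \<circ> X"

definition equivariant_labelling :: "nat \<Rightarrow> 'v set \<Rightarrow> (('v \<Rightarrow> nat) \<Rightarrow> nat) \<Rightarrow> bool" where
  "equivariant_labelling p V lab \<longleftrightarrow>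
     (\<forall>X\<in>nonzero_vectors p V. lab X \<in> {1..p} \<and> lab (rotv p X) = rot p (lab X))"

text \<open>Evaluation of a cochain on a chain of the order complex built by coning off, one coordinate
  at a time, the images of the previous chain under \<open>w - 1\<close> and \<open>1 + w + \<dots> + w\<^bsup>p-1\<^esup>\<close>.\<close>

primrec fundamental_chain :: "nat \<Rightarrow> 'v list \<Rightarrow> (('v \<Rightarrow> nat) list \<Rightarrow> int) \<Rightarrow> int" where
  "fundamental_chain p [] f = f []"
| "fundamental_chain p (v # vs) f =
     fundamental_chain p vs
       (periodic_diff (rotv p) p (length vs) (prism (\<lambda>X. X(v := 1)) (\<lambda>_. 0) f))"

lemma nonzero_vectors_mono: "V \<subseteq> W \<Longrightarrow> nonzero_vectors p V \<subseteq> nonzero_vectors p W"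
  by (auto simp: nonzero_vectors_def)

lemma rotv_pow: "(rotv p ^^ s) X = (rot p ^^ s) \<circ> X"
  by (induction s) (auto simp: rotv_def)

lemma rotv_pow_self: "rotv p ^^ p = id"
  by (auto simp: fun_eq_iff rotv_pow rot_pow_self)

lemma rotv_in_nonzero_vectors: "X \<in> nonzero_vectors p V \<Longrightarrow> rotv p X \<in> nonzero_vectors p V"
  by (auto simp: nonzero_vectors_def rotv_def fun_eq_iff rot_def)

lemma rotv_pow_in_nonzero_vectors:
  "X \<in> nonzero_vectors p V \<Longrightarrow> (rotv p ^^ s) X \<in> nonzero_vectors p V"
  by (induction s) (auto simp: rotv_in_nonzero_vectors)

lemma extends_rotv: "extends X Y \<Longrightarrow> extends (rotv p X) (rotv p Y)"
  by (auto simp: extends_def rotv_def)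

lemma extends_rotv_pow: "extends X Y \<Longrightarrow> extends ((rotv p ^^ s) X) ((rotv p ^^ s) Y)"
  by (induction s) (auto simp: extends_rotv)

lemma vector_chain_rotv_pow:
  "vector_chain p V c \<Longrightarrow> vector_chain p V (map (rotv p ^^ s) c)"
  by (auto simp: vector_chain_def rotv_pow_in_nonzero_vectors sorted_wrt_map subset_iff
      intro: sorted_wrt_mono_rel[of _ extends] extends_rotv_pow)

lemma sorted_wrt_take_Suc_drop:
  assumes "sorted_wrt R c" "x \<in> set (take (Suc j) c)" "z \<in> set (drop j c)"
  shows "x = z \<or> R x z"
proof -
  from assms(3) have "j < length c" by (cases "j < length c") auto
  then have split: "take (Suc j) c = take j c @ [c ! j]" "drop j c = c ! j # drop (Suc j) c"
    by (simp_all add: take_Suc_conv_app_nth Cons_nth_drop_Suc)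
  have "sorted_wrt R (take j c @ drop j c)" using assms(1) by simp
  then show ?thesis using assms(2,3) split by (auto simp: sorted_wrt_append)
qed

lemma vector_chain_prism:
  assumes c: "vector_chain p V c" and "v \<notin> V" "p \<ge> 1"
  shows "vector_chain p (insert v V) (take i c @ map (\<lambda>X. X(v := 1)) (drop i ((\<lambda>_. 0) # c)))"
proof -
  define g :: "('a \<Rightarrow> nat) \<Rightarrow> 'a \<Rightarrow> nat" where "g X = X(v := 1)" for X
  have in_c: "X \<in> nonzero_vectors p V" if "X \<in> set c" for X
    using c that by (auto simp: vector_chain_def)
  have "set (take i c) \<subseteq> nonzero_vectors p (insert v V)"
    using in_c nonzero_vectors_mono[of V "insert v V" p] set_take_subset[of i c] by blast
  moreover have "g X \<in> nonzero_vectors p (insert v V)" if "X \<in> set (drop i ((\<lambda>_. 0) # c))" for X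
  proof -
    have "X = (\<lambda>_. 0) \<or> X \<in> set c" using in_set_dropD[OF that] by simp
    then show ?thesis
      using in_c[of X] \<open>p \<ge> 1\<close> by (auto simp: nonzero_vectors_def g_def fun_eq_iff)
  qed
  moreover have "sorted_wrt extends (take i c)" "sorted_wrt extends (map g (drop i ((\<lambda>_. 0) # c)))"
  proof -
    have sorted: "sorted_wrt extends ((\<lambda>_. 0) # c)"
      using c by (auto simp: vector_chain_def extends_def)
    then show "sorted_wrt extends (take i c)" by (simp add: sorted_wrt_take)
    have "extends (g X) (g Y)" if "extends X Y" for X Y
      using that by (auto simp: extends_def g_def)
    then show "sorted_wrt extends (map g (drop i ((\<lambda>_. 0) # c)))"
      unfolding sorted_wrt_map by (rule sorted_wrt_mono_rel[OF _ sorted_wrt_drop[OF sorted]])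
  qed
  moreover have "extends X (g Y)"
    if X: "X \<in> set (take i c)" and Y: "Y \<in> set (drop i ((\<lambda>_. 0) # c))" for X Y
  proof -
    obtain j where j: "i = Suc j" using X by (cases i) auto
    then have "X = Y \<or> extends X Y"
      using c X Y by (intro sorted_wrt_take_Suc_drop) (auto simp: vector_chain_def)
    moreover have "X v = 0"
      using in_c[OF in_set_takeD[OF X]] \<open>v \<notin> V\<close> by (simp add: nonzero_vectors_def)
    ultimately show ?thesis by (auto simp: extends_def g_def)
  qed
  ultimately show ?thesis
    unfolding vector_chain_def g_def[symmetric] by (auto simp: sorted_wrt_append)
qed

lemma fundamental_chain_diff:
  "fundamental_chain p vs (\<lambda>c. f c - g c) = fundamental_chain p vs f - fundamental_chain p vs g"
  by (induction vs arbitrary: f g) (auto simp: prism_diff[abs_def] periodic_diff_diff[abs_def])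

lemma fundamental_chain_zero: "fundamental_chain p vs (\<lambda>c. 0) = 0"
  using fundamental_chain_diff[of p vs "\<lambda>c. 0" "\<lambda>c. 0"] by simp

lemma fundamental_chain_cong_mod:
  assumes "\<And>c. length c = length vs \<Longrightarrow> vector_chain p (set vs) c \<Longrightarrow> [f c = g c] (mod m)"
    and "distinct vs" "p \<ge> 1"
  shows "[fundamental_chain p vs f = fundamental_chain p vs g] (mod m)"
  using assms
proof (induction vs arbitrary: f g)
  case Nil
  then show ?case by (auto simp: vector_chain_def)
next
  case (Cons v vs)
  have prism: "[prism (\<lambda>X. X(v := 1)) (\<lambda>_. 0) f c = prism (\<lambda>X. X(v := 1)) (\<lambda>_. 0) g c] (mod m)"
    if "length c = length vs" "vector_chain p (set vs) c" for c
  proof (intro prism_cong_mod Cons.prems(1))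
    fix i assume "i \<le> length c"
    then show "length (take i c @ map (\<lambda>X. X(v := 1)) (drop i ((\<lambda>_. 0) # c))) = length (v # vs)"
      using that by simp
    show "vector_chain p (set (v # vs)) (take i c @ map (\<lambda>X. X(v := 1)) (drop i ((\<lambda>_. 0) # c)))"
      unfolding list.set(2) using that Cons.prems(2,3) by (intro vector_chain_prism) simp_all
  qed
  show ?case
    unfolding fundamental_chain.simps
    using Cons.prems(2,3)
    by (intro Cons.IH periodic_diff_cong_mod prism vector_chain_rotv_pow) simp_all
qed

lemma fundamental_chain_coboundary:
  "fundamental_chain p (v # vs) (coboundary f)
   = fundamental_chain p vs (periodic_diff (rotv p) p (length vs) f)"
proof (induction vs arbitrary: v f)
  case Nil
  then show ?case by (simp add: periodic_diff_def)
next
  case (Cons u us)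
  define D where "D = periodic_diff (rotv p :: ('a \<Rightarrow> nat) \<Rightarrow> _) p"
  define h where "h = prism (\<lambda>X. X(v := 1)) (\<lambda>_. 0) f"
  have "prism (\<lambda>X. X(v := 1)) (\<lambda>_. 0) (coboundary f) = (\<lambda>c. f c - coboundary h c)"
    by (simp add: fun_eq_iff prism_coboundary h_def)
  then have "fundamental_chain p (v # u # us) (coboundary f)
     = fundamental_chain p (u # us) (D (Suc (length us)) (\<lambda>c. f c - coboundary h c))"
    by (simp add: D_def)
  also have "D (Suc (length us)) (\<lambda>c. f c - coboundary h c)
     = (\<lambda>c. D (Suc (length us)) f c - coboundary (D (Suc (length us)) h) c)"
    by (simp add: fun_eq_iff D_def periodic_diff_diff coboundary_periodic_diff)
  also have "fundamental_chain p (u # us) \<dots> = fundamental_chain p (u # us) (D (Suc (length us)) f)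
     - fundamental_chain p (u # us) (coboundary (D (Suc (length us)) h))"
    by (rule fundamental_chain_diff)
  also have "fundamental_chain p (u # us) (coboundary (D (Suc (length us)) h))
     = fundamental_chain p us (D (length us) (D (Suc (length us)) h))"
    unfolding D_def by (rule Cons.IH)
  also have "\<dots> = 0"
  proof (cases "us = []")
    case True
    then show ?thesis by (simp add: D_def periodic_diff_def)
  next
    case False
    then have "D (length us) (D (Suc (length us)) h) = (\<lambda>c. 0)"
      unfolding D_def by (intro ext periodic_diff_periodic_diff rotv_pow_self) auto
    then show ?thesis by (simp add: fundamental_chain_zero)
  qed
  finally show ?case by (simp add: D_def)
qed

text \<open>The invariant of dimension shifting along the periodic resolution, for a cochain of degree
  \<open>k - 1\<close>.\<close>

definition resolution_cocycle :: "nat \<Rightarrow> nat \<Rightarrow> (nat list \<Rightarrow> int) \<Rightarrow> bool" where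
  "resolution_cocycle p k \<gamma> \<longleftrightarrow> normalized_cochain \<gamma> \<and>
     (\<forall>c. length c = Suc k \<longrightarrow> set c \<subseteq> {1..p} \<longrightarrow> [coboundary \<gamma> c = 0] (mod int p)) \<and>
     (\<forall>c. length c = k \<longrightarrow> set c \<subseteq> {1..p} \<longrightarrow>
        [periodic_diff (rot p) p (Suc k) \<gamma> c = 0] (mod int p))"

lemma resolution_cocycle_one: "resolution_cocycle p 1 (\<lambda>c. if length c = 1 then 1 else 0)"
  (is "resolution_cocycle p 1 ?\<epsilon>")
proof -
  have "?\<epsilon> c = 0" if "\<not> distinct_adj c" for c :: "nat list"
    using that by (cases c rule: remdups_adj.cases) auto
  moreover have "coboundary ?\<epsilon> c = 0" if "length c = 2" for c :: "nat list"
  proof -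
    from that obtain x y where "c = [x, y]"
      by (auto simp: numeral_2_eq_2 length_Suc_conv)
    then show ?thesis by simp
  qed
  ultimately show ?thesis
    by (auto simp: resolution_cocycle_def normalized_cochain_def periodic_diff_def cong_0_iff
        numeral_2_eq_2)
qed

lemma resolution_cocycle_Suc:
  assumes \<gamma>: "resolution_cocycle p k \<gamma>" and "k \<ge> 1"
  obtains \<beta> where "resolution_cocycle p (Suc k) (coboundary \<beta>)"
    and "\<And>c. length c = k \<Longrightarrow> set c \<subseteq> {1..p} \<Longrightarrow> [periodic_diff (rot p) p k \<beta> c = \<gamma> c] (mod int p)"
proof -
  from \<gamma> \<open>k \<ge> 1\<close> obtain \<beta> where \<beta>: "normalized_cochain \<beta>"
    and preimage: "\<And>c. length c = k \<Longrightarrow> set c \<subseteq> {1..p} \<Longrightarrow>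
      [periodic_diff (rot p) p k \<beta> c = \<gamma> c] (mod int p)"
    using periodic_diff_rot_exact[of k \<gamma> p "int p"] unfolding resolution_cocycle_def by metis
  have "[periodic_diff (rot p) p (Suc (Suc k)) (coboundary \<beta>) c = 0] (mod int p)"
    if c: "length c = Suc k" "set c \<subseteq> {1..p}" for c
  proof -
    have "periodic_diff (rot p) p (Suc (Suc k)) (coboundary \<beta>) c
        = coboundary (periodic_diff (rot p) p k \<beta>) c"
      using \<open>k \<ge> 1\<close> by (subst coboundary_periodic_diff) (simp add: periodic_diff_def)
    also have "[\<dots> = coboundary \<gamma> c] (mod int p)"
      using c by (intro coboundary_cong_mod preimage) auto
    also have "[coboundary \<gamma> c = 0] (mod int p)"
      using \<gamma> c by (simp add: resolution_cocycle_def)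
    finally show ?thesis .
  qed
  then have "resolution_cocycle p (Suc k) (coboundary \<beta>)"
    using normalized_cochain_coboundary[OF \<beta>]
    by (simp add: resolution_cocycle_def coboundary_coboundary)
  then show ?thesis using preimage that by blast
qed

lemma periodic_diff_labelling:
  assumes lab: "equivariant_labelling p V lab" and c: "set c \<subseteq> nonzero_vectors p V"
  shows "periodic_diff (rotv p) p k (\<lambda>c. \<beta> (map lab c)) c = periodic_diff (rot p) p k \<beta> (map lab c)"
proof -
  have "lab ((rotv p ^^ s) X) = (rot p ^^ s) (lab X)" if "X \<in> nonzero_vectors p V" for X s
    using lab rotv_pow_in_nonzero_vectors[OF that]
    by (induction s) (auto simp: equivariant_labelling_def)
  then have "map lab (map (rotv p ^^ s) c) = map (rot p ^^ s) (map lab c)" for s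
    using c by auto
  from this this[of 1] show ?thesis
    by (simp add: periodic_diff_def del: map_map)
qed

lemma fundamental_chain_dimension_shift:
  assumes lab: "equivariant_labelling p (set vs) lab" and "distinct vs" "p \<ge> 1"
    and preimage: "\<And>c. length c = length vs \<Longrightarrow> set c \<subseteq> {1..p} \<Longrightarrow>
      [periodic_diff (rot p) p (length vs) \<beta> c = \<gamma> c] (mod m)"
  shows "[fundamental_chain p (v # vs) (\<lambda>c. coboundary \<beta> (map lab c))
    = fundamental_chain p vs (\<lambda>c. \<gamma> (map lab c))] (mod m)"
proof -
  have "fundamental_chain p (v # vs) (\<lambda>c. coboundary \<beta> (map lab c))
      = fundamental_chain p vs (periodic_diff (rotv p) p (length vs) (\<lambda>c. \<beta> (map lab c)))"
    unfolding coboundary_map[symmetric] by (rule fundamental_chain_coboundary)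
  also have "[\<dots> = fundamental_chain p vs (\<lambda>c. \<gamma> (map lab c))] (mod m)"
  proof (rule fundamental_chain_cong_mod)
    fix c assume c: "length c = length vs" "vector_chain p (set vs) c"
    then have "set c \<subseteq> nonzero_vectors p (set vs)" by (simp add: vector_chain_def)
    moreover from this have "set (map lab c) \<subseteq> {1..p}"
      using lab by (auto simp: equivariant_labelling_def)
    ultimately show "[periodic_diff (rotv p) p (length vs) (\<lambda>c. \<beta> (map lab c)) c
        = \<gamma> (map lab c)] (mod m)"
      using c(1) by (subst periodic_diff_labelling[OF lab]) (simp_all add: preimage)
  qed (use assms in auto)
  finally show ?thesis .
qed

lemma fundamental_chain_labelling:
  assumes "vs \<noteq> []" "distinct vs" "p \<ge> 1" "equivariant_labelling p (set vs) lab"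
  shows "\<exists>\<gamma>. resolution_cocycle p (length vs) \<gamma> \<and>
     [fundamental_chain p vs (\<lambda>c. \<gamma> (map lab c)) = 1] (mod int p)"
  using assms
proof (induction vs rule: list_nonempty_induct)
  case (single v)
  have "fundamental_chain p [v] (\<lambda>c. if length (map lab c) = 1 then 1 else 0) = 1"
    by (simp add: periodic_diff_def)
  then show ?case
    using resolution_cocycle_one[of p] by (intro exI[of _ "\<lambda>c. if length c = 1 then 1 else 0"]) simp
next
  case (cons v vs)
  have lab: "equivariant_labelling p (set vs) lab"
    using cons.prems(3) nonzero_vectors_mono[of "set vs" "set (v # vs)" p]
    by (auto simp: equivariant_labelling_def)
  with cons obtain \<gamma> where \<gamma>: "resolution_cocycle p (length vs) \<gamma>"
    and one: "[fundamental_chain p vs (\<lambda>c. \<gamma> (map lab c)) = 1] (mod int p)"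
    by auto
  have "length vs \<ge> 1" using cons.hyps by (simp add: Suc_leI)
  from resolution_cocycle_Suc[OF \<gamma> this] obtain \<beta>
    where cocycle: "resolution_cocycle p (Suc (length vs)) (coboundary \<beta>)"
      and "\<And>c. length c = length vs \<Longrightarrow> set c \<subseteq> {1..p} \<Longrightarrow>
        [periodic_diff (rot p) p (length vs) \<beta> c = \<gamma> c] (mod int p)"
    by blast
  then have "[fundamental_chain p (v # vs) (\<lambda>c. coboundary \<beta> (map lab c))
      = fundamental_chain p vs (\<lambda>c. \<gamma> (map lab c))] (mod int p)"
    using cons.prems lab by (intro fundamental_chain_dimension_shift) simp_all
  also note one
  finally show ?case using cocycle by auto
qed

lemma equivariant_labelling_chain:
  assumes "p \<ge> 2" "finite V" "V \<noteq> {}" "equivariant_labelling p V lab"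
  obtains c where "length c = card V" "vector_chain p V c" "distinct_adj (map lab c)"
proof -
  obtain vs where vs: "set vs = V" "distinct vs" using finite_distinct_list[OF \<open>finite V\<close>] by blast
  then have "vs \<noteq> []" using \<open>V \<noteq> {}\<close> by auto
  then obtain \<gamma> where \<gamma>: "normalized_cochain \<gamma>"
    and one: "[fundamental_chain p vs (\<lambda>c. \<gamma> (map lab c)) = 1] (mod int p)"
    using fundamental_chain_labelling[of vs p lab] assms vs by (auto simp: resolution_cocycle_def)
  have "\<exists>c. length c = card V \<and> vector_chain p V c \<and> distinct_adj (map lab c)"
  proof (rule ccontr)
    assume "\<not> ?thesis"
    then have "\<not> distinct_adj (map lab c)"
      if "length c = length vs" "vector_chain p (set vs) c" for c
      using that vs distinct_card[OF vs(2)] by auto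
    then have "[fundamental_chain p vs (\<lambda>c. \<gamma> (map lab c))
        = fundamental_chain p vs (\<lambda>c. 0)] (mod int p)"
      using \<gamma> vs(2) \<open>p \<ge> 2\<close>
      by (intro fundamental_chain_cong_mod) (simp_all add: normalized_cochain_def)
    then have "[1 = 0] (mod int p)"
      using one by (metis cong_sym cong_trans fundamental_chain_zero)
    then show False using \<open>p \<ge> 2\<close> by (simp add: cong_0_iff)
  qed
  then show ?thesis using that by blast
qed

section \<open>Alternating vectors\<close>

definition support :: "('v \<Rightarrow> nat) \<Rightarrow> 'v set" where
  "support X = {i. X i \<noteq> 0}"

definition alternating :: "('v::linorder \<Rightarrow> nat) \<Rightarrow> 'v set \<Rightarrow> bool" where
  "alternating X B \<longleftrightarrow> (\<forall>i\<in>B. \<forall>j\<in>B. i < j \<longrightarrow> {i<..<j} \<inter> B = {} \<longrightarrow> X i \<noteq> X j)"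

definition alternation :: "('v::linorder \<Rightarrow> nat) \<Rightarrow> nat" where
  "alternation X = Max (card ` {B. B \<subseteq> support X \<and> alternating X B})"

definition first_entry :: "('v::linorder \<Rightarrow> nat) \<Rightarrow> nat" where
  "first_entry X = X (Min (support X))"

lemma extends_support: "extends X Y \<Longrightarrow> support X \<subseteq> support Y"
  by (auto simp: extends_def support_def)

lemma nonzero_vectors_support:
  assumes "X \<in> nonzero_vectors p V" "finite V"
  shows "support X \<subseteq> V" "finite (support X)" "support X \<noteq> {}"
proof -
  show "support X \<subseteq> V" "support X \<noteq> {}"
    using assms(1) by (auto simp: nonzero_vectors_def support_def)
  then show "finite (support X)" using assms(2) finite_subset by blast
qed

lemma alternating_cong: "(\<And>i. i \<in> B \<Longrightarrow> X i = Y i) \<Longrightarrow> alternating X B \<longleftrightarrow> alternating Y B"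
  by (simp add: alternating_def)

lemma alternating_insert_less:
  assumes "alternating X B" "finite B" "\<forall>b\<in>B. i < b" "B \<noteq> {} \<Longrightarrow> X i \<noteq> X (Min B)"
  shows "alternating X (insert i B)"
  unfolding alternating_def
proof (intro ballI impI)
  fix a b assume ab: "a \<in> insert i B" "b \<in> insert i B" "a < b" "{a<..<b} \<inter> insert i B = {}"
  then have "b \<in> B" using assms(3) by auto
  show "X a \<noteq> X b"
  proof (cases "a = i")
    case True
    have "Min B \<in> B" "Min B \<le> b" using \<open>b \<in> B\<close> assms(2) by (auto intro: Min_in)
    then have "Min B = b" using ab(4) True assms(3) by fastforce
    with True assms(4) \<open>b \<in> B\<close> show ?thesis by auto
  next
    case False
    then have "a \<in> B" "{a<..<b} \<inter> B = {}" using ab(1,4) by auto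
    then show ?thesis using \<open>b \<in> B\<close> ab(3) assms(1) by (simp add: alternating_def)
  qed
qed

lemma finite_alternating_sets: "finite (support X) \<Longrightarrow> finite {B. B \<subseteq> support X \<and> alternating X B}"
  by (rule finite_subset[of _ "Pow (support X)"]) auto

lemma card_alternating_le:
  assumes "finite (support X)" "B \<subseteq> support X" "alternating X B"
  shows "card B \<le> alternation X"
  unfolding alternation_def using assms finite_alternating_sets[OF assms(1)] by (intro Max_ge) auto

lemma alternation_attained:
  assumes "finite (support X)"
  obtains B where "B \<subseteq> support X" "alternating X B" "card B = alternation X"
proof -
  have "alternating X {}" by (simp add: alternating_def)
  then have "alternation X \<in> card ` {B. B \<subseteq> support X \<and> alternating X B}"
    unfolding alternation_def using finite_alternating_sets[OF assms] by (intro Max_in) auto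
  then show ?thesis using that by auto
qed

lemma alternation_pos:
  assumes "finite (support X)" "support X \<noteq> {}"
  shows "0 < alternation X"
proof -
  obtain i where "i \<in> support X" using assms(2) by auto
  then have "card {i} \<le> alternation X"
    by (intro card_alternating_le assms) (auto simp: alternating_def)
  then show ?thesis by simp
qed

lemma alternating_extends:
  assumes "extends X Y" "B \<subseteq> support X" "alternating X B"
  shows "alternating Y B"
proof -
  have "X i = Y i" if "i \<in> B" for i
    using that assms(1,2) by (auto simp: extends_def support_def)
  then show ?thesis using assms(3) alternating_cong by blast
qed

lemma alternation_mono:
  assumes "extends X Y" "finite (support Y)"
  shows "alternation X \<le> alternation Y"
proof -
  have sub: "support X \<subseteq> support Y" using assms(1) by (rule extends_support)
  obtain B where B: "B \<subseteq> support X" "alternating X B" "card B = alternation X"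
    using alternation_attained finite_subset[OF sub assms(2)] by metis
  then show ?thesis
    using card_alternating_le[OF assms(2), of B] alternating_extends[OF assms(1)] sub by auto
qed

lemma maximum_alternating_first_entry:
  assumes fin: "finite (support X)"
    and B: "B \<subseteq> support X" "alternating X B" "card B = alternation X"
    and "B \<noteq> {}"
  shows "X (Min B) = first_entry X"
proof (rule ccontr)
  define a where "a = Min (support X)"
  assume "X (Min B) \<noteq> first_entry X"
  then have different: "X a \<noteq> X (Min B)" by (simp add: first_entry_def a_def)
  have "finite B" using B(1) fin by (rule finite_subset)
  have "a \<in> support X" using B(1) fin \<open>B \<noteq> {}\<close> unfolding a_def by (intro Min_in) auto
  have "a \<le> Min B"
    using B(1) fin \<open>finite B\<close> \<open>B \<noteq> {}\<close> unfolding a_def by (intro Min_antimono)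
  with different have "a < Min B" by (auto simp: order_less_le)
  then have less: "\<forall>b\<in>B. a < b" using \<open>finite B\<close> Min_le less_le_trans by blast
  then have "alternating X (insert a B)"
    using B(2) \<open>finite B\<close> different by (intro alternating_insert_less)
  then have "card (insert a B) \<le> alternation X"
    using \<open>a \<in> support X\<close> B(1) fin by (intro card_alternating_le) auto
  then show False using B(3) \<open>finite B\<close> less by (auto simp: card_insert_if split: if_splits)
qed

lemma first_entry_eq:
  assumes ext: "extends X Y" and fin: "finite (support Y)" and "support X \<noteq> {}"
    and eq: "alternation X = alternation Y"
  shows "first_entry X = first_entry Y"
proof -
  have sub: "support X \<subseteq> support Y" using ext by (rule extends_support)
  then have finX: "finite (support X)" using fin by (rule finite_subset)
  obtain B where B: "B \<subseteq> support X" "alternating X B" "card B = alternation X"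
    using alternation_attained finX by metis
  have "B \<noteq> {}" using alternation_pos[OF finX assms(3)] B(3) by auto
  have "finite B" using B(1) finX by (rule finite_subset)
  then have "Min B \<in> support X" using B(1) \<open>B \<noteq> {}\<close> Min_in by blast
  then have "X (Min B) = Y (Min B)" using ext by (simp add: extends_def support_def)
  moreover have "X (Min B) = first_entry X"
    using maximum_alternating_first_entry[OF finX B \<open>B \<noteq> {}\<close>] .
  moreover have "Y (Min B) = first_entry Y"
    using B sub eq alternating_extends[OF ext B(1,2)] \<open>B \<noteq> {}\<close>
    by (intro maximum_alternating_first_entry[OF fin]) auto
  ultimately show ?thesis by simp
qed

lemma support_rotv: "support (rotv p X) = support X"
  by (auto simp: support_def rotv_def)

lemma alternation_rotv: "alternation (rotv p X) = alternation X"
proof -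
  have "alternating (rotv p X) = alternating X"
    by (simp add: alternating_def fun_eq_iff rotv_def rot_eq_iff)
  then show ?thesis by (simp add: alternation_def support_rotv)
qed

section \<open>Edges and colorings of Kneser hypergraphs\<close>

lemma proper_coloring_not_constant:
  "proper_coloring H k c \<Longrightarrow> e \<in> edges H \<Longrightarrow> \<exists>v\<in>e. c v \<noteq> a"
  by (auto simp: proper_coloring_def)

lemma inj_on_subsets_disjoint_family:
  assumes "disjoint_family_on B I" "\<And>i. i \<in> I \<Longrightarrow> e i \<subseteq> B i \<and> e i \<noteq> {}"
  shows "inj_on e I"
  using assms unfolding inj_on_def disjoint_family_on_def
  by (metis Int_absorb Int_mono subset_empty)

lemma image_disjoint_family_in_KG:
  assumes "disjoint_family_on B I" "card I = r"
    and e: "\<And>i. i \<in> I \<Longrightarrow> e i \<in> edges H \<and> e i \<subseteq> B i \<and> e i \<noteq> {}"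
  shows "e ` I \<in> edges (KG r H)"
proof -
  have "inj_on e I" using assms(1) e by (intro inj_on_subsets_disjoint_family) auto
  then have "card (e ` I) = r" using assms(2) by (simp add: card_image)
  moreover have "pairwise disjnt (e ` I)"
    unfolding pairwise_image
  proof (rule pairwiseI, intro impI)
    fix i j assume "i \<in> I" "j \<in> I" "i \<noteq> j"
    then have "B i \<inter> B j = {}" using assms(1) by (simp add: disjoint_family_on_def)
    then show "disjnt (e i) (e j)"
      using e[OF \<open>i \<in> I\<close>] e[OF \<open>j \<in> I\<close>] by (auto simp: disjnt_def)
  qed
  ultimately show ?thesis using e by (auto simp: KG_def)
qed

lemma enumerate_KG_edge:
  assumes "F \<in> edges (KG r H)" "r \<ge> 1"
  obtains B where "bij_betw B {1..r} F" "disjoint_family_on B {1..r}"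
proof -
  have F: "card F = r" "pairwise disjnt F" using assms(1) by (auto simp: KG_def)
  then have "finite F" using \<open>r \<ge> 1\<close> by (intro card_ge_0_finite) simp
  then obtain B where B: "bij_betw B {1..r} F" using ex_bij_betw_nat_finite_1[of F] F(1) by auto
  have "disjoint_family_on B {1..r}"
    unfolding disjoint_family_on_def
  proof (intro ballI impI)
    fix i j assume ij: "i \<in> {1..r}" "j \<in> {1..r}" "i \<noteq> j"
    then have "B i \<noteq> B j" using bij_betw_imp_inj_on[OF B] by (simp add: inj_on_eq_iff)
    moreover have "B i \<in> F" "B j \<in> F" using bij_betwE[OF B] ij by blast+
    ultimately show "B i \<inter> B j = {}" using F(2) by (simp add: pairwise_def disjnt_def)
  qed
  with B show ?thesis by (rule that)
qed

lemma finite_edges_KG: "finite (edges H) \<Longrightarrow> finite (edges (KG r H))"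
  by (rule finite_subset[of _ "Pow (edges H)"]) (auto simp: KG_def)

lemma UN_in_KG_mult:
  assumes "{} \<notin> edges H" "a \<ge> 1" "b \<ge> 1" and G: "G \<in> edges (KG a (V, T))"
    and F: "\<And>A. A \<in> G \<Longrightarrow> F A \<in> edges (KG b (induced H A))"
  shows "(\<Union>A\<in>G. F A) \<in> edges (KG (a * b) H)"
proof -
  have "finite G" using G \<open>a \<ge> 1\<close> by (auto simp: KG_def intro!: card_ge_0_finite)
  have F_sub: "F A \<subseteq> edges H" "\<forall>e\<in>F A. e \<subseteq> A" "card (F A) = b" "pairwise disjnt (F A)"
    if "A \<in> G" for A
    using F[OF that] by (auto simp: KG_def induced_def)
  have separated: "disjnt e e'" if "A \<in> G" "A' \<in> G" "A \<noteq> A'" "e \<in> F A" "e' \<in> F A'" for A A' e e'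
  proof -
    have "disjnt A A'" using G that by (auto simp: KG_def pairwise_def)
    moreover have "e \<subseteq> A" "e' \<subseteq> A'" using F_sub that by blast+
    ultimately show ?thesis by (auto simp: disjnt_def)
  qed
  have "card (\<Union>A\<in>G. F A) = (\<Sum>A\<in>G. card (F A))"
  proof (rule card_UN_disjoint[OF \<open>finite G\<close>])
    show "\<forall>A\<in>G. finite (F A)" using F_sub(3) \<open>b \<ge> 1\<close> by (auto intro: card_ge_0_finite)
    have "\<not> disjnt e e" if "A \<in> G" "e \<in> F A" for A e
      using that F_sub(1) assms(1) by (auto simp: disjnt_def)
    then show "\<forall>A\<in>G. \<forall>A'\<in>G. A \<noteq> A' \<longrightarrow> F A \<inter> F A' = {}" using separated by blast
  qed
  also have "\<dots> = a * b" using F_sub(3) G by (simp add: KG_def)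
  finally have "card (\<Union>A\<in>G. F A) = a * b" .
  moreover have "pairwise disjnt (\<Union>A\<in>G. F A)"
  proof (rule pairwiseI)
    fix e e' assume "e \<in> (\<Union>A\<in>G. F A)" "e' \<in> (\<Union>A\<in>G. F A)" "e \<noteq> e'"
    then obtain A A' where "A \<in> G" "A' \<in> G" "e \<in> F A" "e' \<in> F A'" by auto
    then show "disjnt e e'"
      using separated F_sub(4) \<open>e \<noteq> e'\<close> by (cases "A = A'") (auto simp: pairwise_def)
  qed
  ultimately show ?thesis using F_sub(1) by (auto simp: KG_def)
qed

definition admissible :: "nat \<Rightarrow> 'v::linorder hypergraph \<Rightarrow> ('v \<Rightarrow> nat) \<Rightarrow> bool" where
  "admissible r H Z \<longleftrightarrow> (\<forall>i. Z i \<le> r) \<and> support Z \<subseteq> verts H \<and> alternating Z (support Z) \<and>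
     (\<forall>i\<in>{1..r}. \<forall>e\<in>edges H. \<not> e \<subseteq> Z -` {i})"

definition alternation_bound :: "nat \<Rightarrow> nat \<Rightarrow> 'v::linorder hypergraph \<Rightarrow> bool" where
  "alternation_bound r C H \<longleftrightarrow>
     (\<exists>Z. admissible r H Z \<and> card (verts H) \<le> card (support Z) + C * (r - 1))"

lemma admissible_zero: "{} \<notin> edges H \<Longrightarrow> admissible r H (\<lambda>_. 0)"
  by (auto simp: admissible_def support_def alternating_def)

section \<open>The alternation bound for a prime number of parts\<close>

text \<open>An equivariant choice of a residue for every proper nonempty subset of \<open>\<int>\<^sub>p\<close>; it exists
  because \<open>p\<close> is prime.\<close>

definition mean_residue :: "nat \<Rightarrow> nat set \<Rightarrow> nat" where
  "mean_residue p A = (SOME y. y \<in> {1..p} \<and> [y * card A = \<Sum>A] (mod p))"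

lemma coprime_card_proper_subset:
  assumes "prime p" "A \<subset> {1..p}" "A \<noteq> {}"
  shows "coprime (card A) p"
proof -
  have "finite A" using assms(2) finite_subset by blast
  then have "0 < card A" using assms(3) by (simp add: card_gt_0_iff)
  moreover have "card A < p" using psubset_card_mono[OF _ assms(2)] by simp
  ultimately have "\<not> p dvd card A" using dvd_imp_le by fastforce
  then show ?thesis using assms(1) by (simp add: coprime_commute prime_imp_coprime)
qed

lemma ex_residue_atLeastAtMost:
  fixes x :: nat
  assumes "p > 0"
  shows "\<exists>y\<in>{1..p}. [y = x] (mod p)"
proof (cases "p dvd x")
  case True
  then show ?thesis using assms by (intro bexI[of _ p]) (auto simp: cong_def)
next
  case False
  then have "x mod p \<in> {1..p}"
    using assms by (auto simp: dvd_eq_mod_eq_0 Suc_le_eq less_imp_le)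
  then show ?thesis by (intro bexI[of _ "x mod p"]) (simp_all add: cong_def)
qed

lemma residue_atLeastAtMost_unique:
  fixes x y :: nat
  assumes "x \<in> {1..p}" "y \<in> {1..p}" "[x = y] (mod p)"
  shows "x = y"
  using assms by (cases "x = p"; cases "y = p") (auto simp: cong_def)

lemma mean_residue:
  assumes "prime p" "A \<subset> {1..p}" "A \<noteq> {}"
  shows "mean_residue p A \<in> {1..p}" "[mean_residue p A * card A = \<Sum>A] (mod p)"
proof -
  obtain u where u: "[card A * u = 1] (mod p)"
    using coprime_card_proper_subset[OF assms] cong_solve_coprime_nat by auto
  obtain y where y: "y \<in> {1..p}" "[y = \<Sum>A * u] (mod p)"
    using ex_residue_atLeastAtMost[of p "\<Sum>A * u"] assms(1) by (auto simp: prime_gt_0_nat)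
  have "[y * card A = \<Sum>A * u * card A] (mod p)" using y(2) by (rule cong_scalar_right)
  also have "\<Sum>A * u * card A = \<Sum>A * (card A * u)" by (simp add: mult_ac)
  also have "[\<dots> = \<Sum>A * 1] (mod p)" using u by (rule cong_scalar_left)
  finally have "y \<in> {1..p} \<and> [y * card A = \<Sum>A] (mod p)" using y(1) by simp
  then have "mean_residue p A \<in> {1..p} \<and> [mean_residue p A * card A = \<Sum>A] (mod p)"
    unfolding mean_residue_def by (rule someI)
  then show "mean_residue p A \<in> {1..p}" "[mean_residue p A * card A = \<Sum>A] (mod p)" by auto
qed

lemma rot_cong_Suc: "i \<in> {1..p} \<Longrightarrow> [rot p i = Suc i] (mod p)"
  by (simp add: rot_eq_mod cong_def mod_Suc_eq)

lemma rot_image_psubset: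
  assumes "A \<subset> {1..p}"
  shows "rot p ` A \<subset> {1..p}"
proof -
  have "inj_on (rot p) {1..p}" by (simp add: inj_on_def rot_eq_iff)
  then have "rot p ` A \<subset> rot p ` {1..p}" using assms by (rule image_strict_mono)
  then show ?thesis by (simp only: rot_image)
qed

lemma mean_residue_rot_image:
  assumes "prime p" and A: "A \<subset> {1..p}" "A \<noteq> {}"
  shows "mean_residue p (rot p ` A) = rot p (mean_residue p A)"
proof (rule residue_atLeastAtMost_unique)
  note mean = mean_residue[OF assms]
  have rot_A: "rot p ` A \<subset> {1..p}" "rot p ` A \<noteq> {}"
    using rot_image_psubset[OF A(1)] A(2) by auto
  note mean_rot = mean_residue[OF \<open>prime p\<close> rot_A]
  then show "mean_residue p (rot p ` A) \<in> {1..p}" by simp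
  show "rot p (mean_residue p A) \<in> {1..p}" using mean(1) by (rule rot_in)
  have inj: "inj_on (rot p) A" by (simp add: inj_on_def rot_eq_iff)
  have "[mean_residue p (rot p ` A) * card A = \<Sum>(rot p ` A)] (mod p)"
    using mean_rot(2) by (simp add: card_image inj)
  also have "\<Sum>(rot p ` A) = (\<Sum>i\<in>A. rot p i)" by (simp add: sum.reindex inj)
  also have "[\<dots> = (\<Sum>i\<in>A. i + 1)] (mod p)"
    using A(1) rot_cong_Suc by (intro cong_sum) auto
  also have "(\<Sum>i\<in>A. i + 1) = \<Sum>A + card A" by (simp only: sum.distrib) simp
  also have "[\<Sum>A + card A = mean_residue p A * card A + card A] (mod p)"
    using mean(2) by (intro cong_add cong_refl) (rule cong_sym)
  also have "mean_residue p A * card A + card A = Suc (mean_residue p A) * card A" by simp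
  also have "[\<dots> = rot p (mean_residue p A) * card A] (mod p)"
    using rot_cong_Suc[OF mean(1)] by (intro cong_scalar_right) (rule cong_sym)
  finally show "[mean_residue p (rot p ` A) = rot p (mean_residue p A)] (mod p)"
    using coprime_card_proper_subset[OF assms] by (simp add: cong_mult_rcancel_nat)
qed

lemma sorted_wrt_less_rank:
  fixes rank :: "'a \<Rightarrow> nat"
  assumes "sorted_wrt R c" "distinct_adj (map lab c)"
    and "\<And>x y. x \<in> set c \<Longrightarrow> y \<in> set c \<Longrightarrow> R x y \<Longrightarrow> rank x \<le> rank y"
    and "\<And>x y. x \<in> set c \<Longrightarrow> y \<in> set c \<Longrightarrow> R x y \<Longrightarrow> rank x = rank y \<Longrightarrow> lab x = lab y"
  shows "sorted_wrt (<) (map rank c)"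
  using assms
proof (induction c rule: induct_list012)
  case (3 x y c)
  have "sorted_wrt (<) (map rank (y # c))"
    by (rule "3.IH"(2)) (use "3.prems" in auto)
  moreover have "rank x < rank y"
    using "3.prems"(1,2) "3.prems"(3,4)[of x y] by (fastforce simp: order_less_le)
  ultimately show ?case by auto
qed auto

locale prime_kneser_coloring =
  fixes p :: nat and H :: "'v::linorder hypergraph" and C :: nat and col :: "'v set \<Rightarrow> nat"
  assumes prime: "prime p" and finite_verts: "finite (verts H)" and nonempty_edges: "{} \<notin> edges H"
    and proper: "proper_coloring (KG p H) C col"
begin

definition color_parts :: "('v \<Rightarrow> nat) \<Rightarrow> nat \<Rightarrow> nat set" where
  "color_parts X c = {i\<in>{1..p}. \<exists>e\<in>edges H. col e = c \<and> e \<subseteq> X -` {i}}"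

definition num_color_parts :: "('v \<Rightarrow> nat) \<Rightarrow> nat" where
  "num_color_parts X = (\<Sum>c<C. card (color_parts X c))"

definition max_admissible :: nat where
  "max_admissible = Max ((\<lambda>Z. card (support Z)) ` {Z. admissible p H Z})"

definition label :: "('v \<Rightarrow> nat) \<Rightarrow> nat" where
  "label X = (if alternation X \<le> max_admissible then first_entry X
     else mean_residue p (color_parts X (LEAST c. color_parts X c \<noteq> {})))"

text \<open>The rank does not decrease along extensions and is constant only where the label is, so a
  chain with distinct consecutive labels is at most as long as there are ranks.\<close>

definition rank :: "('v \<Rightarrow> nat) \<Rightarrow> nat" where
  "rank X = (if alternation X \<le> max_admissible then alternation X
     else max_admissible + num_color_parts X)"

abbreviation (input) "vectors \<equiv> nonzero_vectors p (verts H)"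

lemma color_less: "e \<in> edges H \<Longrightarrow> col e < C"
  using proper by (auto simp: proper_coloring_def KG_def)

lemma finite_admissible_cards: "finite ((\<lambda>Z. card (support Z)) ` {Z. admissible p H Z})"
  by (rule finite_subset[of _ "{..card (verts H)}"])
     (auto simp: admissible_def intro: card_mono finite_verts)

lemma admissible_le_max: "admissible p H Z \<Longrightarrow> card (support Z) \<le> max_admissible"
  unfolding max_admissible_def using finite_admissible_cards by (intro Max_ge) auto

lemma max_admissible_attained:
  obtains Z where "admissible p H Z" "card (support Z) = max_admissible"
proof -
  have "max_admissible \<in> (\<lambda>Z. card (support Z)) ` {Z. admissible p H Z}"
    unfolding max_admissible_def
    using finite_admissible_cards admissible_zero[OF nonempty_edges] by (intro Max_in) auto
  then show ?thesis using that by auto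
qed

lemma finite_color_parts: "finite (color_parts X c)"
  by (simp add: color_parts_def)

lemma color_parts_psubset: "color_parts X c \<subset> {1..p}"
proof
  show "color_parts X c \<noteq> {1..p}"
  proof
    assume "color_parts X c = {1..p}"
    then have "\<forall>i\<in>{1..p}. \<exists>e. e \<in> edges H \<and> col e = c \<and> e \<subseteq> X -` {i}"
      unfolding color_parts_def by blast
    then obtain e where e: "\<And>i. i \<in> {1..p} \<Longrightarrow> e i \<in> edges H \<and> col (e i) = c \<and> e i \<subseteq> X -` {i}"
      by metis
    have "e i \<noteq> {}" if "i \<in> {1..p}" for i using e[OF that] nonempty_edges by auto
    with e have "e ` {1..p} \<in> edges (KG p H)"
      by (intro image_disjoint_family_in_KG[of "\<lambda>i. X -` {i}"]) (auto simp: disjoint_family_on_def)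
    then show False using proper_coloring_not_constant[OF proper, of _ c] e by blast
  qed
qed (auto simp: color_parts_def)

lemma color_parts_mono: "extends X Y \<Longrightarrow> color_parts X c \<subseteq> color_parts Y c"
  unfolding color_parts_def extends_def by fastforce

lemma color_parts_rotv: "color_parts (rotv p X) c = rot p ` color_parts X c"
proof -
  have "color_parts (rotv p X) c = {i\<in>rot p ` {1..p}. \<exists>e\<in>edges H. col e = c \<and> e \<subseteq> rotv p X -` {i}}"
    by (simp only: color_parts_def rot_image)
  also have "\<dots> = rot p ` {i\<in>{1..p}. \<exists>e\<in>edges H. col e = c \<and> e \<subseteq> rotv p X -` {rot p i}}"
    by blast
  also have "\<dots> = rot p ` color_parts X c"
    by (simp add: color_parts_def rotv_def vimage_def rot_eq_iff)
  finally show ?thesis .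
qed

lemma color_parts_eq_empty: "C \<le> c \<Longrightarrow> color_parts X c = {}"
  by (auto simp: color_parts_def dest: color_less)

lemma color_parts_nonempty:
  assumes X: "X \<in> vectors" and large: "alternation X > max_admissible"
  obtains c where "c < C" "color_parts X c \<noteq> {}"
proof -
  obtain B where B: "B \<subseteq> support X" "alternating X B" "card B = alternation X"
    using alternation_attained nonzero_vectors_support[OF X finite_verts] by metis
  define Z where "Z i = (if i \<in> B then X i else 0)" for i
  have supp: "support Z = B" using B(1) by (auto simp: support_def Z_def)
  have "\<not> admissible p H Z" using admissible_le_max[of Z] large supp B(3) by auto
  moreover have "alternating Z B" using B(2) alternating_cong[of B X Z] by (simp add: Z_def)
  moreover have "\<forall>i. Z i \<le> p" "B \<subseteq> verts H"
    using X B(1) nonzero_vectors_support[OF X finite_verts]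
    by (auto simp: Z_def nonzero_vectors_def)
  ultimately obtain i e where ie: "i \<in> {1..p}" "e \<in> edges H" "e \<subseteq> Z -` {i}"
    unfolding admissible_def supp by blast
  then have "e \<subseteq> X -` {i}" by (auto simp: Z_def split: if_splits)
  with ie have "i \<in> color_parts X (col e)" by (auto simp: color_parts_def)
  then show ?thesis using that ie(2) color_less by blast
qed

lemma num_color_parts_le: "num_color_parts X \<le> C * (p - 1)"
proof -
  have "card (color_parts X c) \<le> p - 1" for c
    using psubset_card_mono[OF _ color_parts_psubset[of X c]] by simp
  then show ?thesis
    using sum_bounded_above[of "{..<C}" "\<lambda>c. card (color_parts X c)" "p - 1"]
    by (simp add: num_color_parts_def)
qed

lemma num_color_parts_pos:
  assumes "X \<in> vectors" "alternation X > max_admissible"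
  shows "0 < num_color_parts X"
proof -
  obtain c where c: "c < C" "color_parts X c \<noteq> {}" using color_parts_nonempty[OF assms] .
  then have "0 < card (color_parts X c)" using finite_color_parts by (simp add: card_gt_0_iff)
  also have "\<dots> \<le> num_color_parts X"
    unfolding num_color_parts_def using c by (intro member_le_sum) auto
  finally show ?thesis .
qed

lemma num_color_parts_mono: "extends X Y \<Longrightarrow> num_color_parts X \<le> num_color_parts Y"
  unfolding num_color_parts_def using color_parts_mono finite_color_parts
  by (intro sum_mono card_mono)

lemma color_parts_eq_if_num_eq:
  assumes ext: "extends X Y" and eq: "num_color_parts X = num_color_parts Y"
  shows "color_parts X = color_parts Y"
proof
  fix c
  show "color_parts X c = color_parts Y c"
  proof (cases "c < C")
    case True
    have "card (color_parts X i) \<le> card (color_parts Y i)" for i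
      using color_parts_mono[OF ext] finite_color_parts by (rule card_mono[rotated])
    then have "card (color_parts X c) = card (color_parts Y c)"
      using sum_mono_inv[OF eq[unfolded num_color_parts_def]] True by simp
    then show ?thesis using color_parts_mono[OF ext] finite_color_parts card_subset_eq by metis
  qed (simp add: color_parts_eq_empty)
qed

lemma equivariant_label: "equivariant_labelling p (verts H) label"
  unfolding equivariant_labelling_def
proof
  fix X assume X: "X \<in> vectors"
  show "label X \<in> {1..p} \<and> label (rotv p X) = rot p (label X)"
  proof (cases "alternation X \<le> max_admissible")
    case True
    have "Min (support X) \<in> support X"
      using nonzero_vectors_support[OF X finite_verts] by simp
    then have "first_entry X \<in> {1..p}"
      using X by (auto simp: first_entry_def support_def nonzero_vectors_def)
    moreover have "first_entry (rotv p X) = rot p (first_entry X)"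
      by (simp add: first_entry_def support_rotv) (simp add: rotv_def)
    ultimately show ?thesis using True by (simp add: label_def alternation_rotv)
  next
    case False
    define A where "A = color_parts X (LEAST c. color_parts X c \<noteq> {})"
    obtain c where "color_parts X c \<noteq> {}" using color_parts_nonempty[OF X] False by (metis not_le)
    then have "A \<noteq> {}" unfolding A_def by (rule LeastI)
    moreover have "A \<subset> {1..p}" unfolding A_def by (rule color_parts_psubset)
    moreover have "label X = mean_residue p A" "label (rotv p X) = mean_residue p (rot p ` A)"
      using False by (simp_all add: label_def A_def alternation_rotv color_parts_rotv)
    ultimately show ?thesis
      using mean_residue(1)[OF prime] mean_residue_rot_image[OF prime] by simp
  qed
qed

lemma rank_in_range:
  assumes "X \<in> vectors"
  shows "rank X \<in> {1..max_admissible + C * (p - 1)}"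
  using num_color_parts_le[of X] num_color_parts_pos[OF assms]
    alternation_pos[OF nonzero_vectors_support(2,3)[OF assms finite_verts]]
  by (auto simp: rank_def Suc_le_eq)

lemma rank_extends:
  assumes X: "X \<in> vectors" and Y: "Y \<in> vectors" and ext: "extends X Y"
  shows "rank X \<le> rank Y" "rank X = rank Y \<Longrightarrow> label X = label Y"
proof -
  note supports = nonzero_vectors_support[OF X finite_verts]
    nonzero_vectors_support[OF Y finite_verts]
  have mono: "alternation X \<le> alternation Y" using ext supports by (intro alternation_mono)
  consider (small) "alternation Y \<le> max_admissible"
    | (crossing) "alternation X \<le> max_admissible" "max_admissible < alternation Y"
    | (large) "max_admissible < alternation X"
    by linarith
  then have "rank X \<le> rank Y \<and> (rank X = rank Y \<longrightarrow> label X = label Y)"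
  proof cases
    case small
    then show ?thesis
      using mono first_entry_eq[OF ext] supports by (simp add: rank_def label_def)
  next
    case crossing
    then show ?thesis using num_color_parts_pos[OF Y] by (simp add: rank_def)
  next
    case large
    then show ?thesis
      using mono num_color_parts_mono[OF ext] color_parts_eq_if_num_eq[OF ext]
      by (simp add: rank_def label_def)
  qed
  then show "rank X \<le> rank Y" "rank X = rank Y \<Longrightarrow> label X = label Y" by auto
qed

lemma card_verts_le: "card (verts H) \<le> max_admissible + C * (p - 1)"
proof (cases "verts H = {}")
  case False
  then obtain c where c: "length c = card (verts H)" "vector_chain p (verts H) c"
    "distinct_adj (map label c)"
    using equivariant_labelling_chain finite_verts equivariant_label prime_ge_2_nat[OF prime]
    by metis
  then have vectors: "set c \<subseteq> vectors" "sorted_wrt extends c" by (auto simp: vector_chain_def)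
  then have "sorted_wrt (<) (map rank c)"
    using c(3) rank_extends
    by (intro sorted_wrt_less_rank[where R = extends and lab = label]) blast+
  then have "distinct (map rank c)" using strict_sorted_iff by blast
  then have "card (verts H) = card (rank ` set c)" using c(1) distinct_card[of "map rank c"] by simp
  also have "\<dots> \<le> card {1..max_admissible + C * (p - 1)}"
    using vectors(1) rank_in_range by (intro card_mono image_subsetI) auto
  finally show ?thesis by simp
qed simp

lemma alternation_bound_prime: "alternation_bound p C H"
  using max_admissible_attained card_verts_le unfolding alternation_bound_def by metis

end

section \<open>The alternation bound for an arbitrary number of parts\<close>

definition product_vector :: "nat \<Rightarrow> ('v \<Rightarrow> nat) \<Rightarrow> (nat \<Rightarrow> 'v \<Rightarrow> nat) \<Rightarrow> 'v \<Rightarrow> nat" where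
  "product_vector b Y W j = (if Y j = 0 \<or> W (Y j) j = 0 then 0 else (Y j - 1) * b + W (Y j) j)"

lemma mult_add_inj_nat:
  fixes b k k' u u' :: nat
  assumes "u * b + k = u' * b + k'" "1 \<le> k" "k \<le> b" "1 \<le> k'" "k' \<le> b"
  shows "u = u'" "k = k'"
proof -
  show "u = u'"
    using assms mult_le_mono1[of "Suc u" u' b] mult_le_mono1[of "Suc u'" u b]
    by (cases u u' rule: linorder_cases) auto
  with assms(1) show "k = k'" by simp
qed

locale product_vectors =
  fixes a b :: nat and H :: "'v::linorder hypergraph" and Y :: "'v \<Rightarrow> nat" and W :: "nat \<Rightarrow> 'v \<Rightarrow> nat"
  assumes Y_le: "Y j \<le> a" and support_Y: "support Y \<subseteq> verts H"
    and W: "i \<in> {1..a} \<Longrightarrow> admissible b (induced H (Y -` {i})) (W i)"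
begin

lemma W_le: "i \<in> {1..a} \<Longrightarrow> W i j \<le> b"
  using W by (auto simp: admissible_def)

lemma support_W: "i \<in> {1..a} \<Longrightarrow> support (W i) \<subseteq> Y -` {i}"
  using W by (simp add: admissible_def induced_def)

lemma support_W_subset_verts:
  assumes "i \<in> {1..a}"
  shows "support (W i) \<subseteq> verts H"
proof -
  have "Y -` {i} \<subseteq> support Y" using assms by (auto simp: support_def)
  then show ?thesis using support_W[OF assms] support_Y by blast
qed

lemma Y_in_range: "Y j \<noteq> 0 \<Longrightarrow> Y j \<in> {1..a}"
  using Y_le[of j] by simp

lemma support_product_vector: "support (product_vector b Y W) = (\<Union>i\<in>{1..a}. support (W i))"
proof (intro set_eqI iffI)
  fix j assume "j \<in> support (product_vector b Y W)"
  then have "Y j \<noteq> 0" "W (Y j) j \<noteq> 0"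
    by (auto simp: support_def product_vector_def split: if_splits)
  then show "j \<in> (\<Union>i\<in>{1..a}. support (W i))"
    using Y_in_range by (auto simp: support_def)
next
  fix j assume "j \<in> (\<Union>i\<in>{1..a}. support (W i))"
  then obtain i where i: "i \<in> {1..a}" "j \<in> support (W i)" by auto
  then have "Y j = i" using support_W by auto
  then show "j \<in> support (product_vector b Y W)"
    using i by (auto simp: support_def product_vector_def)
qed

lemma product_vector_le: "product_vector b Y W j \<le> a * b"
proof (cases "Y j = 0 \<or> W (Y j) j = 0")
  case False
  then have Y: "Y j \<in> {1..a}" using Y_in_range by blast
  then have "(Y j - 1) * b + W (Y j) j \<le> (Y j - 1) * b + b" using W_le by simp
  also have "\<dots> = Y j * b" using Y by (cases "Y j") auto
  also have "\<dots> \<le> a * b" using Y by simp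
  finally show ?thesis using False by (simp add: product_vector_def)
qed (auto simp: product_vector_def)

lemma product_vector_eqD:
  assumes "product_vector b Y W i = product_vector b Y W j" "product_vector b Y W i \<noteq> 0"
  shows "Y i = Y j" "W (Y i) i = W (Y i) j" "Y i \<in> {1..a}" "W (Y i) i \<in> {1..b}"
proof -
  have nonzero: "Y i \<noteq> 0" "W (Y i) i \<noteq> 0" "Y j \<noteq> 0" "W (Y j) j \<noteq> 0"
    using assms by (auto simp: product_vector_def split: if_splits)
  then have "(Y i - 1) * b + W (Y i) i = (Y j - 1) * b + W (Y j) j"
    using assms(1) by (simp add: product_vector_def)
  from mult_add_inj_nat[OF this] nonzero W_le[OF Y_in_range]
  have "Y i - 1 = Y j - 1" "W (Y i) i = W (Y j) j" by (auto simp: Suc_le_eq)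
  moreover from this(1) show "Y i = Y j" using nonzero by simp
  ultimately show "W (Y i) i = W (Y i) j" by simp
  show "Y i \<in> {1..a}" "W (Y i) i \<in> {1..b}"
    using nonzero W_le[OF Y_in_range] Y_in_range by (auto simp: Suc_le_eq)
qed

lemma alternating_product_vector:
  "alternating (product_vector b Y W) (support (product_vector b Y W))"
  unfolding alternating_def
proof (intro ballI impI notI)
  fix i j
  assume ij: "i \<in> support (product_vector b Y W)" "i < j"
    "{i<..<j} \<inter> support (product_vector b Y W) = {}"
    and eq: "product_vector b Y W i = product_vector b Y W j"
  have "product_vector b Y W i \<noteq> 0" using ij(1) by (simp add: support_def)
  note parts = product_vector_eqD[OF eq this]
  have "alternating (W (Y i)) (support (W (Y i)))"
    using W[OF parts(3)] by (simp add: admissible_def)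
  moreover have "{i<..<j} \<inter> support (W (Y i)) = {}"
    using ij(3) support_product_vector parts(3) by blast
  moreover have "i \<in> support (W (Y i))" "j \<in> support (W (Y i))"
    using parts(2,4) by (auto simp: support_def)
  ultimately show False using parts(2) ij(2) unfolding alternating_def by blast
qed

lemma admissible_product_vector:
  assumes "{} \<notin> edges H"
  shows "admissible (a * b) H (product_vector b Y W)"
  unfolding admissible_def
proof (intro conjI allI ballI notI)
  show "support (product_vector b Y W) \<subseteq> verts H"
    using support_W_subset_verts unfolding support_product_vector by blast
next
  fix k e assume k: "k \<in> {1..a * b}" and e: "e \<in> edges H" "e \<subseteq> product_vector b Y W -` {k}"
  obtain i where i: "i \<in> e" using assms e(1) by (metis ex_in_conv)
  then have nonzero: "product_vector b Y W i \<noteq> 0" using e(2) k by auto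
  have "product_vector b Y W i = product_vector b Y W j" if "j \<in> e" for j
    using i that e(2) by auto
  note parts = product_vector_eqD[OF this nonzero]
  have e_sub: "e \<subseteq> Y -` {Y i}" "e \<subseteq> W (Y i) -` {W (Y i) i}"
    using parts(1,2) by force+
  then have "e \<in> edges (induced H (Y -` {Y i}))"
    using e(1) by (simp add: induced_def)
  then show False
    using W[OF parts(3)[OF i]] parts(4)[OF i] e_sub(2) unfolding admissible_def by blast
qed (rule product_vector_le alternating_product_vector)+

lemma card_support_product_vector:
  assumes "finite (verts H)"
  shows "card (support (product_vector b Y W)) = (\<Sum>i\<in>{1..a}. card (support (W i)))"
  unfolding support_product_vector
proof (rule card_UN_disjoint)
  show "\<forall>i\<in>{1..a}. finite (support (W i))"
    using support_W_subset_verts assms finite_subset by blast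
  show "\<forall>i\<in>{1..a}. \<forall>j\<in>{1..a}. i \<noteq> j \<longrightarrow> support (W i) \<inter> support (W j) = {}"
    using support_W by blast
qed simp

end

lemma alternation_bound_mult:
  fixes H :: "'v::linorder hypergraph"
  assumes fin: "finite (verts H)" and nonempty: "{} \<notin> edges H" and "a \<ge> 1" "b \<ge> 1"
    and bound: "alternation_bound a C
      (verts H, {A. A \<subseteq> verts H \<and> \<not> alternation_bound b C (induced H A)})"
  shows "alternation_bound (a * b) C H"
proof -
  obtain Y where Y: "admissible a
      (verts H, {A. A \<subseteq> verts H \<and> \<not> alternation_bound b C (induced H A)}) Y"
    and card_Y: "card (verts H) \<le> card (support Y) + C * (a - 1)"
    using bound by (auto simp: alternation_bound_def)
  have part_sub: "Y -` {i} \<subseteq> verts H" if "i \<in> {1..a}" for i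
    using Y that by (auto simp: admissible_def support_def)
  have "alternation_bound b C (induced H (Y -` {i}))" if "i \<in> {1..a}" for i
    using Y part_sub[OF that] that unfolding admissible_def snd_conv by blast
  then have "\<exists>Z. admissible b (induced H (Y -` {i})) Z \<and>
      card (Y -` {i}) \<le> card (support Z) + C * (b - 1)"
    if "i \<in> {1..a}" for i
    using that by (simp add: alternation_bound_def induced_def)
  then obtain W where W: "\<And>i. i \<in> {1..a} \<Longrightarrow> admissible b (induced H (Y -` {i})) (W i)"
    and card_W: "\<And>i. i \<in> {1..a} \<Longrightarrow> card (Y -` {i}) \<le> card (support (W i)) + C * (b - 1)"
    by metis
  interpret product_vectors a b H Y W
    using Y W by unfold_locales (auto simp: admissible_def)
  have "support Y = (\<Union>i\<in>{1..a}. Y -` {i})"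
    using Y_in_range by (auto simp: support_def)
  also have "card \<dots> = (\<Sum>i\<in>{1..a}. card (Y -` {i}))"
    using part_sub fin finite_subset by (intro card_UN_disjoint) blast+
  also have "\<dots> \<le> (\<Sum>i\<in>{1..a}. card (support (W i)) + C * (b - 1))"
    by (intro sum_mono card_W)
  also have "\<dots> = card (support (product_vector b Y W)) + a * (C * (b - 1))"
    by (simp add: card_support_product_vector[OF fin] sum.distrib)
  finally have "card (verts H)
      \<le> card (support (product_vector b Y W)) + (a * (C * (b - 1)) + C * (a - 1))"
    using card_Y by simp
  also have "a * (C * (b - 1)) + C * (a - 1) = C * (a * b - 1)"
    using \<open>a \<ge> 1\<close> \<open>b \<ge> 1\<close> by (cases a; cases b) (auto simp: algebra_simps)
  finally show ?thesis
    using admissible_product_vector[OF nonempty] unfolding alternation_bound_def by blast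
qed

text \<open>Following Alon, Frankl and Lovasz: a set on which the coloring is not proper for \<open>b\<close> is
  colored by the common color of \<open>b\<close> disjoint edges that it contains.\<close>

lemma proper_coloring_KG_factor:
  assumes nonempty: "{} \<notin> edges H" and "a \<ge> 1" "b \<ge> 1"
    and proper: "proper_coloring (KG (a * b) H) C col"
    and improper: "\<And>A. A \<in> T \<Longrightarrow> \<not> proper_coloring (KG b (induced H A)) C col"
  obtains c where "proper_coloring (KG a (V, T)) C c"
proof -
  have less: "col e < C" if "e \<in> edges H" for e
    using proper that by (auto simp: proper_coloring_def KG_def)
  then have "\<exists>F x. F \<in> edges (KG b (induced H A)) \<and> (\<forall>e\<in>F. col e = x)" if "A \<in> T" for A
    using improper[OF that] by (auto simp: proper_coloring_def KG_def induced_def)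
  then obtain F c where F: "\<And>A. A \<in> T \<Longrightarrow> F A \<in> edges (KG b (induced H A)) \<and> (\<forall>e\<in>F A. col e = c A)"
    by metis
  have "c A < C" if "A \<in> T" for A
  proof -
    have "F A \<noteq> {}" "F A \<subseteq> edges H" using F[OF that] \<open>b \<ge> 1\<close> by (auto simp: KG_def induced_def)
    then obtain e where "e \<in> F A" "e \<in> edges H" by blast
    then show ?thesis using F[OF that] less[of e] by simp
  qed
  moreover have "\<exists>A\<in>G. c A \<noteq> x" if G: "G \<in> edges (KG a (V, T))" for G x
  proof (rule ccontr)
    assume "\<not> (\<exists>A\<in>G. c A \<noteq> x)"
    have "G \<subseteq> T" using G by (simp add: KG_def)
    then have "(\<Union>A\<in>G. F A) \<in> edges (KG (a * b) H)"
      using F by (intro UN_in_KG_mult[OF nonempty \<open>a \<ge> 1\<close> \<open>b \<ge> 1\<close> G]) blast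
    from proper_coloring_not_constant[OF proper this] obtain A e
      where "A \<in> G" "e \<in> F A" "col e \<noteq> x" by blast
    moreover from this have "col e = c A" using F[of A] \<open>G \<subseteq> T\<close> by auto
    ultimately show False using \<open>\<not> (\<exists>A\<in>G. c A \<noteq> x)\<close> by simp
  qed
  ultimately have "proper_coloring (KG a (V, T)) C c"
    by (auto simp: proper_coloring_def KG_def)
  then show ?thesis by (rule that)
qed

lemma alternation_bound_composite:
  fixes H :: "'v::linorder hypergraph"
  assumes fin: "finite (verts H)" and nonempty: "{} \<notin> edges H" and factors: "a \<ge> 1" "b \<ge> 1"
    and proper: "proper_coloring (KG (a * b) H) C col"
    and bound_a: "\<And>T c. {} \<notin> T \<Longrightarrow> proper_coloring (KG a (verts H, T)) C c \<Longrightarrow>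
      alternation_bound a C (verts H, T)"
    and bound_b: "\<And>A. A \<subseteq> verts H \<Longrightarrow> proper_coloring (KG b (induced H A)) C col \<Longrightarrow>
      alternation_bound b C (induced H A)"
  shows "alternation_bound (a * b) C H"
proof -
  define T where "T = {A. A \<subseteq> verts H \<and> \<not> alternation_bound b C (induced H A)}"
  have "\<not> proper_coloring (KG b (induced H A)) C col" if "A \<in> T" for A
    using that bound_b by (auto simp: T_def)
  then obtain c where "proper_coloring (KG a (verts H, T)) C c"
    using proper_coloring_KG_factor[OF nonempty factors proper] by blast
  moreover have "{} \<notin> T"
    using nonempty admissible_zero[of "induced H {}" b]
    by (auto simp: T_def alternation_bound_def induced_def)
  ultimately have "alternation_bound a C (verts H, T)" using bound_a by blast
  then show ?thesis unfolding T_def using fin nonempty factors by (intro alternation_bound_mult)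
qed

theorem kneser_alternation_bound:
  fixes H :: "'v::linorder hypergraph"
  assumes "r \<ge> 2" "finite (verts H)" "{} \<notin> edges H" "proper_coloring (KG r H) C col"
  shows "alternation_bound r C H"
  using assms
proof (induction r arbitrary: H col rule: less_induct)
  case (less r)
  show ?case
  proof (cases "prime r")
    case True
    interpret prime_kneser_coloring r H C col by unfold_locales (use less.prems True in auto)
    show ?thesis by (rule alternation_bound_prime)
  next
    case False
    then obtain a b where r: "r = a * b" and "a \<noteq> 1" "a \<noteq> r"
      using less.prems(1) by (auto simp: prime_nat_iff dvd_def)
    then have factors: "a \<ge> 2" "b \<ge> 2"
      using less.prems(1) by (cases a; cases b; auto)+
    then have smaller: "a < r" "b < r" using r by auto
    show ?thesis
      unfolding r
    proof (rule alternation_bound_composite)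
      fix T c assume "{} \<notin> T" "proper_coloring (KG a (verts H, T)) C c"
      then show "alternation_bound a C (verts H, T)"
        using less.IH[OF smaller(1) factors(1), of "(verts H, T)" c] less.prems(2) by simp
    next
      fix A assume "A \<subseteq> verts H" "proper_coloring (KG b (induced H A)) C col"
      moreover have "finite A" using \<open>A \<subseteq> verts H\<close> less.prems(2) by (rule finite_subset)
      ultimately show "alternation_bound b C (induced H A)"
        using less.IH[OF smaller(2) factors(2)] less.prems(3) by (simp add: induced_def)
    qed (use less.prems r factors in auto)
  qed
qed

section \<open>Alternation numbers\<close>

lemma
  shows length_le_alt: "subseq Y X \<Longrightarrow> 0 \<notin> set Y \<Longrightarrow> distinct_adj Y \<Longrightarrow> length Y \<le> alt X"
    and alt_le_length: "alt X \<le> length X"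
proof -
  let ?L = "{length Y |Y. subseq Y X \<and> 0 \<notin> set Y \<and> distinct_adj Y}"
  have "?L \<subseteq> {..length X}" by (auto dest: list_emb_length)
  then have "finite ?L" using finite_subset by blast
  then show "length Y \<le> alt X" if "subseq Y X" "0 \<notin> set Y" "distinct_adj Y"
    unfolding alt_def using that by (intro Max_ge) auto
  have "length ([] :: nat list) \<in> ?L" by force
  then have "alt X \<in> ?L" unfolding alt_def using \<open>finite ?L\<close> by (intro Max_in) auto
  with \<open>?L \<subseteq> _\<close> show "alt X \<le> length X" by auto
qed

definition alt_feasible :: "nat \<Rightarrow> 'a hypergraph \<Rightarrow> (nat \<Rightarrow> 'a) \<Rightarrow> int \<Rightarrow> nat list set" where
  "alt_feasible r H \<sigma> q = {X. length X = card (verts H) \<and> set X \<subseteq> {0..r} \<and>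
       (\<forall>i\<in>{1..r}. int (card (edges (induced H (\<sigma> ` positions X i)))) \<le> q - 1)}"

lemma alt_perm_eq_Max: "alt_perm r H \<sigma> q = Max (alt ` alt_feasible r H \<sigma> q)"
  unfolding alt_perm_def alt_feasible_def by (rule arg_cong[of _ _ Max]) blast

lemma finite_alt_feasible: "finite (alt_feasible r H \<sigma> q)"
  by (rule finite_subset[OF _ finite_lists_length_eq[of "{0..r}" "card (verts H)"]])
     (auto simp: alt_feasible_def)

lemma alt_le_alt_perm: "X \<in> alt_feasible r H \<sigma> q \<Longrightarrow> alt X \<le> alt_perm r H \<sigma> q"
  unfolding alt_perm_eq_Max by (intro Max_ge finite_imageI finite_alt_feasible imageI)

lemma alt_perm_le_card:
  assumes "hypergraph H" "q \<ge> 1"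
  shows "alt_perm r H \<sigma> q \<le> card (verts H)"
proof -
  let ?O = "replicate (card (verts H)) (0::nat)"
  have "edges (induced H (\<sigma> ` positions ?O i)) = {}" if "i \<in> {1..r}" for i
  proof -
    have "positions ?O i = {}" using that by (auto simp: positions_def)
    then show ?thesis using assms(1) by (auto simp: induced_def hypergraph_def)
  qed
  then have "?O \<in> alt_feasible r H \<sigma> q"
    using assms(2) by (auto simp: alt_feasible_def)
  then have "alt_perm r H \<sigma> q \<in> alt ` alt_feasible r H \<sigma> q"
    unfolding alt_perm_eq_Max by (intro Max_in finite_imageI finite_alt_feasible) auto
  then obtain X where "length X = card (verts H)" "alt_perm r H \<sigma> q = alt X"
    by (auto simp: alt_feasible_def)
  then show ?thesis using alt_le_length[of X] by simp
qed

lemma alt_num_attained: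
  assumes "hypergraph H" "q \<ge> 1"
  obtains \<sigma> where "bij_betw \<sigma> {..<card (verts H)} (verts H)" "alt_num r H q = alt_perm r H \<sigma> q"
proof -
  let ?P = "{alt_perm r H \<sigma> q |\<sigma>. bij_betw \<sigma> {..<card (verts H)} (verts H)}"
  have "?P \<subseteq> {..card (verts H)}" using alt_perm_le_card[OF assms] by auto
  then have "finite ?P" using finite_subset by blast
  moreover have "\<exists>\<sigma>. bij_betw \<sigma> {..<card (verts H)} (verts H)"
    using assms(1) by (auto simp: hypergraph_def lessThan_atLeast0 intro: ex_bij_betw_nat_finite)
  ultimately have "alt_num r H q \<in> ?P" unfolding alt_num_def by (intro Min_in) auto
  then show ?thesis using that by auto
qed

lemma distinct_adj_map_alternating:
  assumes "sorted_wrt (<) L" "alternating Z (set L)"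
  shows "distinct_adj (map Z L)"
  using assms
proof (induction L rule: induct_list012)
  case (3 x y L)
  have "{x<..<y} \<inter> set (x # y # L) = {}" using "3.prems"(1) by auto
  then have "Z x \<noteq> Z y" using "3.prems" by (auto simp: alternating_def)
  moreover have "alternating Z (set (y # L))"
    unfolding alternating_def
  proof (intro ballI impI)
    fix i j assume ij: "i \<in> set (y # L)" "j \<in> set (y # L)" "i < j" "{i<..<j} \<inter> set (y # L) = {}"
    have "x < i" using ij(1) "3.prems"(1) by auto
    then have "{i<..<j} \<inter> set (x # y # L) = {}" using ij(4) by auto
    moreover have "i \<in> set (x # y # L)" "j \<in> set (x # y # L)" using ij(1,2) by simp_all
    ultimately show "Z i \<noteq> Z j" using "3.prems"(2) ij(3) unfolding alternating_def by blast
  qed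
  then have "distinct_adj (map Z (y # L))" using "3.IH"(2) "3.prems"(1) by simp
  ultimately show ?case by simp
qed auto

lemma card_support_le_alt:
  assumes "support Z \<subseteq> {..<n}" "alternating Z (support Z)"
  shows "card (support Z) \<le> alt (map Z [0..<n])"
proof -
  define L where "L = filter (\<lambda>j. Z j \<noteq> 0) [0..<n]"
  have "set L = support Z" using assms(1) by (auto simp: L_def support_def)
  have "sorted_wrt (<) L" unfolding L_def by (intro sorted_wrt_filter) simp
  then have "distinct_adj (map Z L)"
    using assms(2) \<open>set L = support Z\<close> by (intro distinct_adj_map_alternating) simp_all
  then have "length (map Z L) \<le> alt (map Z [0..<n])"
    by (intro length_le_alt) (auto simp: L_def intro: subseq_map)
  moreover have "card (support Z) = length (map Z L)"
    using distinct_card[of L] \<open>set L = support Z\<close> by (simp add: L_def)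
  ultimately show ?thesis by simp
qed

definition heavy_hypergraph :: "nat \<Rightarrow> 'a hypergraph \<Rightarrow> 'a hypergraph" where
  "heavy_hypergraph q H = (verts H, {A. A \<subseteq> verts H \<and> q \<le> card (edges (induced H A))})"

definition pullback :: "('b \<Rightarrow> 'a) \<Rightarrow> 'b set \<Rightarrow> 'a hypergraph \<Rightarrow> 'b hypergraph" where
  "pullback \<sigma> V K = (V, {B. B \<subseteq> V \<and> \<sigma> ` B \<in> edges K})"

lemma edges_induced_empty: "hypergraph H \<Longrightarrow> edges (induced H {}) = {}"
  by (auto simp: hypergraph_def induced_def)

lemma proper_coloring_KG_pullback:
  assumes inj: "inj_on \<sigma> V" and proper: "proper_coloring (KG r K) C col"
  shows "proper_coloring (KG r (pullback \<sigma> V K)) C (\<lambda>B. col (\<sigma> ` B))"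
proof -
  have "\<exists>B\<in>F. col (\<sigma> ` B) \<noteq> x" if F: "F \<in> edges (KG r (pullback \<sigma> V K))" for F x
  proof -
    have F_sub: "F \<subseteq> Pow V" and image_sub: "(`) \<sigma> ` F \<subseteq> edges K"
      using F by (auto simp: KG_def pullback_def)
    have "inj_on ((`) \<sigma>) F" using inj_on_image_Pow[OF inj] F_sub by (rule inj_on_subset)
    then have "card ((`) \<sigma> ` F) = r" using F by (simp add: card_image KG_def)
    moreover have "pairwise disjnt ((`) \<sigma> ` F)"
      unfolding pairwise_image
    proof (rule pairwiseI, intro impI)
      fix A B assume AB: "A \<in> F" "B \<in> F" "A \<noteq> B"
      then have "disjnt A B" using F by (simp add: KG_def pairwise_def)
      then show "disjnt (\<sigma> ` A) (\<sigma> ` B)"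
        using disjnt_inj_on_iff[of \<sigma> "Pow V" A B] inj AB F_sub by auto
    qed
    ultimately have "(`) \<sigma> ` F \<in> edges (KG r K)" using image_sub by (simp add: KG_def)
    then show ?thesis using proper_coloring_not_constant[OF proper] by blast
  qed
  moreover have "(\<lambda>B. col (\<sigma> ` B)) ` edges (pullback \<sigma> V K) \<subseteq> {..<C}"
    using proper by (auto simp: proper_coloring_def KG_def pullback_def)
  ultimately show ?thesis by (auto simp: proper_coloring_def KG_def)
qed

theorem card_verts_le_alt_num:
  assumes H: "hypergraph H" and r: "r \<ge> 2" and q: "q \<ge> 1"
    and proper: "proper_coloring (KG r (heavy_hypergraph q H)) C col"
  shows "card (verts H) \<le> alt_num r H (int q) + C * (r - 1)"
proof -
  define n where "n = card (verts H)"
  obtain \<sigma> where \<sigma>: "bij_betw \<sigma> {..<n} (verts H)" "alt_num r H (int q) = alt_perm r H \<sigma> (int q)"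
    using alt_num_attained[OF H, of "int q" r] q n_def by auto
  define K where "K = pullback \<sigma> {..<n} (heavy_hypergraph q H)"
  have "proper_coloring (KG r K) C (\<lambda>B. col (\<sigma> ` B))"
    unfolding K_def using proper \<sigma>(1) by (intro proper_coloring_KG_pullback bij_betw_imp_inj_on)
  moreover have "finite (verts K)" "{} \<notin> edges K"
    using q edges_induced_empty[OF H] by (auto simp: K_def pullback_def heavy_hypergraph_def)
  ultimately have "alternation_bound r C K" using kneser_alternation_bound[OF r] by blast
  then obtain Z where Z: "admissible r K Z" "n \<le> card (support Z) + C * (r - 1)"
    by (auto simp: alternation_bound_def K_def pullback_def)
  have "map Z [0..<n] \<in> alt_feasible r H \<sigma> (int q)"
    unfolding alt_feasible_def
  proof (intro CollectI conjI ballI)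
    show "set (map Z [0..<n]) \<subseteq> {0..r}" using Z(1) by (auto simp: admissible_def)
    fix i assume i: "i \<in> {1..r}"
    let ?P = "positions (map Z [0..<n]) i"
    have P: "?P \<subseteq> Z -` {i}" "?P \<subseteq> {..<n}" by (auto simp: positions_def)
    then have "?P \<notin> edges K" using Z(1) i unfolding admissible_def by blast
    moreover have "\<sigma> ` ?P \<subseteq> verts H" using P(2) \<sigma>(1) by (auto simp: bij_betw_def)
    ultimately show "int (card (edges (induced H (\<sigma> ` ?P)))) \<le> int q - 1"
      using P(2) by (simp add: K_def pullback_def heavy_hypergraph_def)
  qed (simp add: n_def)
  then have "alt (map Z [0..<n]) \<le> alt_num r H (int q)" using alt_le_alt_perm \<sigma>(2) by metis
  moreover have "card (support Z) \<le> alt (map Z [0..<n])"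
    using Z(1) by (intro card_support_le_alt) (auto simp: admissible_def K_def pullback_def)
  ultimately show ?thesis using Z(2) by (simp add: n_def)
qed

section \<open>Obstructions to coloring sparse Kneser hypergraphs\<close>

definition edge_selection :: "nat \<Rightarrow> 'a hypergraph \<Rightarrow> 'a set \<Rightarrow> 'a set set" where
  "edge_selection q H A = (SOME F. F \<subseteq> edges (induced H A) \<and> finite F \<and>
     card F = min q (card (edges (induced H A))))"

definition transversals :: "nat \<Rightarrow> (nat \<Rightarrow> 'b set) \<Rightarrow> 'b set set" where
  "transversals r U = (\<lambda>e. e ` {1..r}) ` (\<Pi>\<^sub>E i\<in>{1..r}. U i)"

text \<open>The functions \<open>X\<close> run over the ordered families of \<open>r\<close> disjoint vertex sets.\<close>

definition obstructions :: "nat \<Rightarrow> nat \<Rightarrow> nat \<Rightarrow> 'a hypergraph \<Rightarrow> (nat \<Rightarrow> 'a set set) set" where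
  "obstructions r q t H = (\<Union>X\<in>verts H \<rightarrow>\<^sub>E {0..r}.
     \<Pi>\<^sub>E i\<in>{1..r}. {U. U \<subseteq> edge_selection q H {v\<in>verts H. X v = i} \<and> card U = t})"

lemma
  shows edge_selection_subset: "edge_selection q H A \<subseteq> edges (induced H A)"
    and finite_edge_selection: "finite (edge_selection q H A)"
    and card_edge_selection: "card (edge_selection q H A) = min q (card (edges (induced H A)))"
proof -
  have "\<exists>F. F \<subseteq> edges (induced H A) \<and> finite F \<and> card F = min q (card (edges (induced H A)))"
    by (rule obtain_subset_with_card_n[OF min.cobounded2]) blast
  from someI_ex[OF this] show "edge_selection q H A \<subseteq> edges (induced H A)"
    "finite (edge_selection q H A)"
    "card (edge_selection q H A) = min q (card (edges (induced H A)))"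
    unfolding edge_selection_def by blast+
qed

lemma finite_obstructions: "finite (verts H) \<Longrightarrow> finite (obstructions r q t H)"
  unfolding obstructions_def
  by (intro finite_UN_I finite_PiE) (simp_all add: finite_edge_selection)

lemma card_obstructions_le:
  assumes "finite (verts H)"
  shows "card (obstructions r q t H) \<le> (r + 1) ^ card (verts H) * (q choose t) ^ r"
proof -
  have "card (obstructions r q t H) \<le> (\<Sum>X\<in>verts H \<rightarrow>\<^sub>E {0..r}. card
      (\<Pi>\<^sub>E i\<in>{1..r}. {U. U \<subseteq> edge_selection q H {v\<in>verts H. X v = i} \<and> card U = t}))"
    unfolding obstructions_def using assms by (intro card_UN_le finite_PiE) auto
  also have "\<dots> \<le> (\<Sum>X\<in>verts H \<rightarrow>\<^sub>E {0..r}. (q choose t) ^ r)"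
  proof (rule sum_mono)
    fix X
    have "card (\<Pi>\<^sub>E i\<in>{1..r}. {U. U \<subseteq> edge_selection q H {v\<in>verts H. X v = i} \<and> card U = t})
        = (\<Prod>i\<in>{1..r}. card (edge_selection q H {v\<in>verts H. X v = i}) choose t)"
      by (simp add: card_PiE n_subsets finite_edge_selection)
    also have "\<dots> \<le> (\<Prod>i\<in>{1..r}. q choose t)"
      by (intro prod_mono) (auto simp: card_edge_selection intro: binomial_right_mono)
    finally show "card (\<Pi>\<^sub>E i\<in>{1..r}. {U. U \<subseteq> edge_selection q H {v\<in>verts H. X v = i} \<and> card U = t})
        \<le> (q choose t) ^ r" by simp
  qed
  also have "\<dots> = (r + 1) ^ card (verts H) * (q choose t) ^ r"
    using assms by (simp add: card_PiE)
  finally show ?thesis .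
qed

lemma transversals_subset_KG:
  assumes "{} \<notin> edges H" and B: "disjoint_family_on B {1..r}"
    and U: "\<And>i. i \<in> {1..r} \<Longrightarrow> U i \<subseteq> edges (induced H (B i))"
  shows "transversals r U \<subseteq> edges (KG r H)"
  unfolding transversals_def
proof (rule image_subsetI, rule image_disjoint_family_in_KG[OF B])
  fix e i assume "e \<in> (\<Pi>\<^sub>E i\<in>{1..r}. U i)" and i: "i \<in> {1..r}"
  then have "e i \<in> U i" by (rule PiE_mem)
  then have "e i \<in> edges (induced H (B i))" using U[OF i] by blast
  then show "e i \<in> edges H \<and> e i \<subseteq> B i \<and> e i \<noteq> {}" using assms(1) by (auto simp: induced_def)
qed simp

lemma card_transversals:
  assumes U: "\<And>i. i \<in> {1..r} \<Longrightarrow> card (U i) = t" and disj: "disjoint_family_on U {1..r}"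
  shows "card (transversals r U) = t ^ r"
proof -
  have "inj_on (\<lambda>e. e ` {1..r}) (\<Pi>\<^sub>E i\<in>{1..r}. U i)"
  proof (rule inj_onI, rule PiE_ext)
    fix e f i assume e: "e \<in> (\<Pi>\<^sub>E i\<in>{1..r}. U i)" and f: "f \<in> (\<Pi>\<^sub>E i\<in>{1..r}. U i)"
      and eq: "e ` {1..r} = f ` {1..r}" and i: "i \<in> {1..r}"
    have "e i \<in> f ` {1..r}" using i unfolding eq[symmetric] by (rule imageI)
    then obtain j where j: "j \<in> {1..r}" "e i = f j" by auto
    then have "e i \<in> U i \<inter> U j" using PiE_mem[OF e i] PiE_mem[OF f j(1)] by simp
    then have "i = j" using disjoint_family_onD[OF disj i j(1)] by auto
    then show "e i = f i" using j(2) by simp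
  qed auto
  then have "card (transversals r U) = (\<Prod>i\<in>{1..r}. card (U i))"
    unfolding transversals_def by (simp add: card_image card_PiE)
  then show ?thesis using U by simp
qed

lemma disjoint_family_on_edges:
  assumes "{} \<notin> edges H" "disjoint_family_on B I"
    and U: "\<And>i. i \<in> I \<Longrightarrow> U i \<subseteq> edges (induced H (B i))"
  shows "disjoint_family_on U I"
  unfolding disjoint_family_on_def
proof (intro ballI impI equals0I)
  fix i j e assume ij: "i \<in> I" "j \<in> I" "i \<noteq> j" and "e \<in> U i \<inter> U j"
  then have "e \<in> edges H" "e \<subseteq> B i \<inter> B j" using U[OF ij(1)] U[OF ij(2)] by (auto simp: induced_def)
  moreover have "B i \<inter> B j = {}" using assms(2) ij by (simp add: disjoint_family_on_def)
  ultimately show False using assms(1) by simp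
qed

lemma obstruction_transversals:
  assumes "{} \<notin> edges H" and "U \<in> obstructions r q t H"
  shows "transversals r U \<subseteq> edges (KG r H)" "card (transversals r U) = t ^ r"
proof -
  obtain X where X: "U \<in> (\<Pi>\<^sub>E i\<in>{1..r}.
      {U. U \<subseteq> edge_selection q H {v\<in>verts H. X v = i} \<and> card U = t})"
    using assms(2) by (auto simp: obstructions_def)
  define B where "B i = {v\<in>verts H. X v = i}" for i
  have disj: "disjoint_family_on B {1..r}" by (auto simp: disjoint_family_on_def B_def)
  have U: "U i \<subseteq> edges (induced H (B i))" "card (U i) = t" if "i \<in> {1..r}" for i
    using PiE_mem[OF X that] edge_selection_subset unfolding B_def by blast+
  show "transversals r U \<subseteq> edges (KG r H)"
    using assms(1) disj U(1) by (rule transversals_subset_KG)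
  show "card (transversals r U) = t ^ r"
    using U(2) disjoint_family_on_edges[OF assms(1) disj U(1)] by (rule card_transversals)
qed

lemma disjoint_family_eq_fibres:
  fixes B :: "nat \<Rightarrow> 'a set"
  assumes sub: "\<And>i. i \<in> {1..r} \<Longrightarrow> B i \<subseteq> V" and disj: "disjoint_family_on B {1..r}"
  obtains X where "X \<in> V \<rightarrow>\<^sub>E {0..r}" "\<forall>i\<in>{1..r}. {v\<in>V. X v = i} = B i"
proof -
  define X where "X = (\<lambda>v\<in>V. \<Sum>i\<in>{i\<in>{1..r}. v \<in> B i}. i)"
  have eq: "X v = i" if "i \<in> {1..r}" "v \<in> B i" for v i
  proof -
    have "{j\<in>{1..r}. v \<in> B j} = {i}"
      using that disj unfolding disjoint_family_on_def by blast
    then show ?thesis using sub that by (auto simp: X_def)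
  qed
  have zero: "X v = 0" if "v \<in> V" "v \<notin> (\<Union>i\<in>{1..r}. B i)" for v
  proof -
    have "{i\<in>{1..r}. v \<in> B i} = {}" using that(2) by blast
    then show ?thesis using that(1) unfolding X_def by simp
  qed
  have "X \<in> V \<rightarrow>\<^sub>E {0..r}"
  proof (rule PiE_I)
    fix v assume "v \<in> V"
    then show "X v \<in> {0..r}"
      using zero[of v] eq[of _ v] by (cases "v \<in> (\<Union>i\<in>{1..r}. B i)") auto
  qed (simp add: X_def)
  moreover have "\<forall>i\<in>{1..r}. {v\<in>V. X v = i} = B i"
  proof (intro ballI equalityI subsetI)
    fix i v assume i: "i \<in> {1..r}" and v: "v \<in> {v\<in>V. X v = i}"
    then have "X v \<noteq> 0" using i by simp
    then have "v \<in> (\<Union>i\<in>{1..r}. B i)" using zero[of v] v by fastforce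
    then obtain j where "j \<in> {1..r}" "v \<in> B j" by blast
    then show "v \<in> B i" using eq[of j v] v by simp
  qed (use eq sub in auto)
  ultimately show ?thesis by (rule that)
qed

lemma pigeonhole_color:
  fixes col :: "'a \<Rightarrow> nat"
  assumes "col ` F \<subseteq> {..<k}" "k * (t - 1) < card F"
  shows "\<exists>j<k. t \<le> card {e\<in>F. col e = j}"
proof -
  have "finite F" "F \<noteq> {}" using assms(2) card_gt_0_iff[of F] by auto
  then have "\<exists>j\<in>{..<k}. card (col -` {j} \<inter> F) * card {..<k} \<ge> card F"
    using assms(1) by (intro pigeonhole_card) auto
  then obtain j where j: "j < k" "card F \<le> card {e\<in>F. col e = j} * k"
    by (auto simp: vimage_def Int_def conj_commute)
  have "k * (t - 1) < card {e\<in>F. col e = j} * k" using assms(2) j(2) by (rule less_le_trans)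
  then have "t - 1 < card {e\<in>F. col e = j}" by (simp add: mult.commute[of k])
  then have "t \<le> card {e\<in>F. col e = j}" by linarith
  then show ?thesis using j(1) by blast
qed

lemma monochromatic_KG_edge:
  assumes "proper_coloring (edges H, J) k col" "hypergraph H" "r \<ge> 2" "q \<ge> 1"
    and few: "k * (t - 1) < q" "alt_num r H (int q) + k * (r - 1) < card (verts H)"
  obtains G x where "G \<in> edges (KG r (heavy_hypergraph q H))"
    "\<forall>A\<in>G. t \<le> card {e\<in>edge_selection q H A. col e = x}"
proof -
  have "\<exists>j<k. t \<le> card {e\<in>edge_selection q H A. col e = j}"
    if "A \<in> edges (heavy_hypergraph q H)" for A
  proof (rule pigeonhole_color)
    show "col ` edge_selection q H A \<subseteq> {..<k}"
      using assms(1) edge_selection_subset[of q H A] by (auto simp: proper_coloring_def induced_def)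
    show "k * (t - 1) < card (edge_selection q H A)"
      using that few(1) by (simp add: card_edge_selection heavy_hypergraph_def)
  qed
  then obtain c where c: "\<And>A. A \<in> edges (heavy_hypergraph q H) \<Longrightarrow>
      c A < k \<and> t \<le> card {e\<in>edge_selection q H A. col e = c A}"
    by metis
  have "\<not> proper_coloring (KG r (heavy_hypergraph q H)) k c"
    using card_verts_le_alt_num[OF assms(2-4)] few(2) not_le by blast
  then obtain G x where G: "G \<in> edges (KG r (heavy_hypergraph q H))" "\<forall>A\<in>G. c A = x"
    using c by (auto simp: proper_coloring_def KG_def)
  have "\<forall>A\<in>G. t \<le> card {e\<in>edge_selection q H A. col e = x}"
  proof
    fix A assume "A \<in> G"
    then have "A \<in> edges (heavy_hypergraph q H)" "c A = x" using G by (auto simp: KG_def)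
    then show "t \<le> card {e\<in>edge_selection q H A. col e = x}" using c by blast
  qed
  with G(1) show ?thesis by (rule that)
qed

lemma few_colors_obstruction:
  assumes proper: "proper_coloring (edges H, J) k col" and H: "hypergraph H" "r \<ge> 2" "q \<ge> 1"
    and "k * (t - 1) < q" "alt_num r H (int q) + k * (r - 1) < card (verts H)"
  shows "\<exists>U\<in>obstructions r q t H. J \<inter> transversals r U = {}"
proof -
  obtain G x where G: "G \<in> edges (KG r (heavy_hypergraph q H))"
    and popular: "\<forall>A\<in>G. t \<le> card {e\<in>edge_selection q H A. col e = x}"
    using monochromatic_KG_edge[OF assms] .
  obtain B where B: "bij_betw B {1..r} G" "disjoint_family_on B {1..r}"
    using enumerate_KG_edge[OF G] H(2) by auto
  then have B_in: "B i \<in> G" if "i \<in> {1..r}" for i using that by (auto simp: bij_betw_def)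
  then have "B i \<subseteq> verts H" if "i \<in> {1..r}" for i
    using G that by (auto simp: KG_def heavy_hypergraph_def)
  from disjoint_family_eq_fibres[OF this B(2)] obtain X
    where X: "X \<in> verts H \<rightarrow>\<^sub>E {0..r}" "\<forall>i\<in>{1..r}. {v\<in>verts H. X v = i} = B i" .
  have "\<exists>U. U \<subseteq> {e\<in>edge_selection q H (B i). col e = x} \<and> card U = t" if "i \<in> {1..r}" for i
    using obtain_subset_with_card_n[OF popular[rule_format, OF B_in[OF that]]] by metis
  then obtain U where U: "\<And>i. i \<in> {1..r} \<Longrightarrow>
      U i \<subseteq> {e\<in>edge_selection q H (B i). col e = x} \<and> card (U i) = t"
    by metis
  show ?thesis
  proof (rule bexI[of _ "restrict U {1..r}"])
    have "restrict U {1..r} \<in> (\<Pi>\<^sub>E i\<in>{1..r}.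
        {U. U \<subseteq> edge_selection q H {v\<in>verts H. X v = i} \<and> card U = t})"
      using U X(2) by (subst restrict_PiE_iff) (auto simp del: atLeastAtMost_iff)
    then show "restrict U {1..r} \<in> obstructions r q t H"
      using X(1) by (auto simp: obstructions_def)
    have "col e = x" if "F \<in> transversals r (restrict U {1..r})" "e \<in> F" for F e
      using that U by (fastforce simp: transversals_def dest: PiE_mem)
    then show "J \<inter> transversals r (restrict U {1..r}) = {}"
      using proper_coloring_not_constant[OF proper] by fastforce
  qed
qed

section \<open>Random Kneser hypergraphs\<close>

lemma chromatic_number_attained:
  assumes "finite (verts G)" "\<And>F. F \<in> edges G \<Longrightarrow> F \<subseteq> verts G \<and> card F \<ge> 2"
  obtains col where "proper_coloring G (chromatic_number G) col"
proof -
  obtain f :: "'a \<Rightarrow> nat" where f: "bij_betw f (verts G) {0..<card (verts G)}"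
    using ex_bij_betw_finite_nat[OF assms(1)] by blast
  have "\<not> (\<exists>a. \<forall>v\<in>F. f v = a)" if F: "F \<in> edges G" for F
  proof
    assume "\<exists>a. \<forall>v\<in>F. f v = a"
    then obtain a where "f ` F \<subseteq> {a}" by auto
    then have "card (f ` F) \<le> 1" using card_mono[of "{a}" "f ` F"] by simp
    moreover have "inj_on f F"
      using f assms(2)[OF F] by (auto simp: bij_betw_def intro: inj_on_subset)
    ultimately show False using assms(2)[OF F] by (simp add: card_image)
  qed
  moreover have "f ` verts G \<subseteq> {..<card (verts G)}" using f by (auto simp: bij_betw_def)
  ultimately have "proper_coloring G (card (verts G)) f" by (simp add: proper_coloring_def)
  then have "\<exists>k c. proper_coloring G k c" by blast
  then have "\<exists>c. proper_coloring G (chromatic_number G) c"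
    unfolding chromatic_number_def by (rule LeastI_ex)
  then show ?thesis using that by blast
qed

lemma prob_Pi_pmf_bernoulli_all_False:
  assumes "finite I" "K \<subseteq> I" "0 \<le> \<rho>" "\<rho> \<le> 1"
  shows "measure_pmf.prob (Pi_pmf I False (\<lambda>_. bernoulli_pmf \<rho>)) {\<omega>. \<forall>F\<in>K. \<not> \<omega> F}
    = (1 - \<rho>) ^ card K"
proof -
  have avoid: "{\<omega>. \<forall>F\<in>K. \<not> \<omega> F} = Pi I (\<lambda>F. if F \<in> K then {False} else UNIV)"
    using assms(2) by (auto simp: Pi_def)
  have "measure_pmf.prob (Pi_pmf I False (\<lambda>_. bernoulli_pmf \<rho>)) {\<omega>. \<forall>F\<in>K. \<not> \<omega> F}
     = (\<Prod>F\<in>I. if F \<in> K then 1 - \<rho> else 1)"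
    unfolding avoid using assms
    by (subst measure_Pi_pmf_Pi) (auto simp: measure_pmf_single intro!: prod.cong)
  also have "\<dots> = (\<Prod>F\<in>K. 1 - \<rho>)"
    using assms by (subst prod.inter_restrict[symmetric]) (auto simp: Int_absorb1)
  finally show ?thesis by simp
qed

lemma prob_random_KG_avoids:
  assumes "finite (edges H)" "K \<subseteq> edges (KG r H)" "0 \<le> \<rho>" "\<rho> \<le> 1"
  shows "measure_pmf.prob (random_KG r H \<rho>) {G. edges G \<inter> K = {}} = (1 - \<rho>) ^ card K"
proof -
  have "(\<lambda>\<omega>. (verts (KG r H), {F \<in> edges (KG r H). \<omega> F})) -` {G. edges G \<inter> K = {}}
      = {\<omega>. \<forall>F\<in>K. \<not> \<omega> F}"
    using assms(2) by auto
  then show ?thesis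
    using prob_Pi_pmf_bernoulli_all_False[OF finite_edges_KG[OF assms(1)] assms(2-4)]
    by (simp add: random_KG_def)
qed

lemma set_pmf_random_KG:
  assumes "G \<in> set_pmf (random_KG r H \<rho>)"
  obtains J where "G = (edges H, J)" "J \<subseteq> edges (KG r H)"
  using assms by (auto simp: random_KG_def KG_def)

lemma prob_few_colors_le:
  assumes H: "hypergraph H" "r \<ge> 2" "q \<ge> 1" and \<rho>: "0 \<le> \<rho>" "\<rho> \<le> 1"
    and few: "\<And>k. P k \<Longrightarrow> k * (t - 1) < q \<and> alt_num r H (int q) + k * (r - 1) < card (verts H)"
  shows "measure_pmf.prob (random_KG r H \<rho>) {G. P (chromatic_number G)}
    \<le> real ((r + 1) ^ card (verts H) * (q choose t) ^ r) * (1 - \<rho>) ^ (t ^ r)"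
proof -
  have fin: "finite (verts H)" "{} \<notin> edges H" using H(1) by (auto simp: hypergraph_def)
  then have finE: "finite (edges H)"
    using H(1) by (intro finite_subset[of "edges H" "Pow (verts H)"]) (auto simp: hypergraph_def)
  have "\<exists>U\<in>obstructions r q t H. edges G \<inter> transversals r U = {}"
    if G: "G \<in> set_pmf (random_KG r H \<rho>)" and "P (chromatic_number G)" for G
  proof -
    obtain J where J: "G = (edges H, J)" "J \<subseteq> edges (KG r H)" using set_pmf_random_KG[OF G] .
    obtain col where "proper_coloring G (chromatic_number G) col"
      by (rule chromatic_number_attained[of G]) (use J finE H(2) in \<open>auto simp: KG_def\<close>)
    then show ?thesis
      using few_colors_obstruction[of H J _ col] few[OF \<open>P _\<close>] H J(1) by simp
  qed
  then have "measure_pmf.prob (random_KG r H \<rho>) {G. P (chromatic_number G)}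
      \<le> measure_pmf.prob (random_KG r H \<rho>)
          (\<Union>U\<in>obstructions r q t H. {G. edges G \<inter> transversals r U = {}})"
    by (intro measure_pmf.finite_measure_mono_AE) (auto simp: AE_measure_pmf_iff)
  also have "\<dots> \<le> (\<Sum>U\<in>obstructions r q t H.
      measure_pmf.prob (random_KG r H \<rho>) {G. edges G \<inter> transversals r U = {}})"
    using finite_obstructions[OF fin(1)]
    by (intro measure_pmf.finite_measure_subadditive_finite) auto
  also have "\<dots> = (\<Sum>U\<in>obstructions r q t H. (1 - \<rho>) ^ (t ^ r))"
    using obstruction_transversals[OF fin(2)] prob_random_KG_avoids[OF finE _ \<rho>]
    by (intro sum.cong) auto
  also have "\<dots> \<le> real ((r + 1) ^ card (verts H) * (q choose t) ^ r) * (1 - \<rho>) ^ (t ^ r)"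
    unfolding sum_constant using card_obstructions_le[OF fin(1)] \<rho>(2)
    by (intro mult_right_mono of_nat_mono) auto
  finally show ?thesis .
qed

lemma power_div_fact_le_exp:
  assumes "x \<ge> 0"
  shows "x ^ n / fact n \<le> exp (x::real)"
proof -
  have "(\<Sum>k\<in>{n}. x ^ k /\<^sub>R fact k) \<le> (\<Sum>k. x ^ k /\<^sub>R fact k)"
    using assms by (intro sum_le_suminf summable_exp_generic) auto
  then show ?thesis by (simp add: exp_def divide_inverse mult.commute)
qed

lemma binomial_le_exp:
  assumes "q \<le> D * t" "D \<ge> 1"
  shows "real (q choose t) \<le> exp (real t * (1 + ln (real D)))"
proof -
  have "real (q choose t) * fact t = real ((q choose t) * fact t)" by simp
  also have "\<dots> \<le> real (q ^ t)" by (intro of_nat_mono binomial_fact_pow)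
  also have "\<dots> \<le> real ((D * t) ^ t)" using assms(1) by (intro of_nat_mono power_mono) auto
  also have "\<dots> = real D ^ t * real t ^ t" by (simp add: power_mult_distrib)
  finally have "real (q choose t) \<le> real D ^ t * (real t ^ t / fact t)" by (simp add: field_simps)
  also have "\<dots> \<le> real D ^ t * exp (real t)" by (intro mult_left_mono power_div_fact_le_exp) auto
  also have "real D ^ t = exp (real t * ln (real D))" using assms(2) by (simp add: exp_of_nat_mult)
  finally show ?thesis by (simp add: exp_add[symmetric] algebra_simps)
qed

lemma union_bound_le_exp:
  assumes "q \<le> D * t" "D \<ge> 1" "0 \<le> \<rho>" "\<rho> \<le> 1"
  shows "real ((r + 1) ^ n * (q choose t) ^ r) * (1 - \<rho>) ^ (t ^ r)
    \<le> exp (real n * ln (real r + 1) + real r * real t * (1 + ln (real D)) - \<rho> * real t ^ r)"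
proof -
  let ?b = "exp (real t * (1 + ln (real D)))"
  have "real ((r + 1) ^ n * (q choose t) ^ r) * (1 - \<rho>) ^ (t ^ r)
      = (real r + 1) ^ n * real (q choose t) ^ r * (1 - \<rho>) ^ (t ^ r)"
    by (simp add: add.commute)
  also have "\<dots> \<le> (real r + 1) ^ n * ?b ^ r * exp (- \<rho>) ^ (t ^ r)"
    using assms exp_ge_add_one_self[of "- \<rho>"] binomial_le_exp[OF assms(1,2)]
    by (intro mult_mono power_mono) auto
  also have "(real r + 1) ^ n = exp (real n * ln (real r + 1))"
    by (simp add: exp_of_nat_mult)
  also have "exp (real n * ln (real r + 1)) * ?b ^ r * exp (- \<rho>) ^ (t ^ r)
      = exp (real n * ln (real r + 1) + real r * (real t * (1 + ln (real D)))
        + real (t ^ r) * (- \<rho>))"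
    by (simp only: exp_add exp_of_nat_mult)
  finally show ?thesis by (simp add: mult.assoc mult.commute[of \<rho>])
qed

lemma prob_chromatic_number_random_KG_less:
  assumes H: "hypergraph H" "r \<ge> 2" "q \<ge> 1" and "D \<ge> 1"
    and q: "D * (t - 1) + 1 \<le> q" "q \<le> D * t" and \<rho>: "0 \<le> \<rho>" "\<rho> \<le> 1"
    and bound: "bound \<le> (real (card (verts H)) - real (alt_num r H (int q))) / (real r - 1)"
      "bound \<le> real D + 1"
  shows "measure_pmf.prob (random_KG r H \<rho>) {G. real (chromatic_number G) < bound}
    \<le> exp (real (card (verts H)) * ln (real r + 1)
        + real r * real t * (1 + ln (real D)) - \<rho> * real t ^ r)"
proof -
  have "k * (t - 1) < q \<and> alt_num r H (int q) + k * (r - 1) < card (verts H)"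
    if k: "real k < bound" for k
  proof
    have "k \<le> D" using k bound(2) by linarith
    then show "k * (t - 1) < q" using q(1) mult_le_mono1[of k D "t - 1"] by linarith
    have "real k < (real (card (verts H)) - real (alt_num r H (int q))) / (real r - 1)"
      using k bound(1) by simp
    then have "real (alt_num r H (int q) + k * (r - 1)) < real (card (verts H))"
      using H(2) by (simp add: pos_less_divide_eq of_nat_diff)
    then show "alt_num r H (int q) + k * (r - 1) < card (verts H)" by (simp only: of_nat_less_iff)
  qed
  from prob_few_colors_le[OF H \<rho> this] union_bound_le_exp[OF q(2) \<open>D \<ge> 1\<close> \<rho>]
  show ?thesis by (rule order_trans)
qed

theorem prob_chromatic_number_random_KG_ge:
  fixes H :: "'a hypergraph" and r :: nat and t d q :: int and \<rho> :: real
  assumes H: "hypergraph H" "r \<ge> 2" and q: "q \<ge> 1" "(d - 1) * (t - 1) + 1 \<le> q" "q \<le> (d - 1) * t"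
    and \<rho>: "0 \<le> \<rho>" "\<rho> \<le> 1"
  defines "bound \<equiv>
    min ((real (card (verts H)) - real (alt_num r H q)) / (real r - 1)) (real_of_int d)"
  shows "1 - exp (real (card (verts H)) * ln (real r + 1)
      + real r * real_of_int t * (1 + ln (real_of_int d - 1)) - \<rho> * real_of_int t ^ r)
    \<le> measure_pmf.prob (random_KG r H \<rho>) {G. bound \<le> real (chromatic_number G)}"
proof (cases "d \<ge> 1")
  case False
  then have "bound \<le> real k" for k unfolding bound_def by linarith
  then show ?thesis by simp
next
  case True
  then have "0 < d - 1" "0 < t" using q(1,3) zero_less_mult_iff[of "d - 1" t] by auto
  moreover define D T Q where "D = nat (d - 1)" and "T = nat t" and "Q = nat q"
  ultimately have nats: "d = int D + 1" "t = int T" "q = int Q" using q(1) by simp_all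
  then have pos: "D \<ge> 1" "T \<ge> 1" "Q \<ge> 1" using \<open>0 < d - 1\<close> \<open>0 < t\<close> q(1) by simp_all
  have "int (D * (T - 1) + 1) \<le> int Q" "int Q \<le> int (D * T)"
    using q(2,3) pos by (simp_all add: nats of_nat_diff)
  then have "D * (T - 1) + 1 \<le> Q" "Q \<le> D * T" by (simp_all only: of_nat_le_iff)
  moreover have "bound \<le> (real (card (verts H)) - real (alt_num r H (int Q))) / (real r - 1)"
    "bound \<le> real D + 1"
    unfolding bound_def nats by simp_all
  ultimately have "measure_pmf.prob (random_KG r H \<rho>) {G. real (chromatic_number G) < bound}
      \<le> exp (real (card (verts H)) * ln (real r + 1)
        + real r * real T * (1 + ln (real D)) - \<rho> * real T ^ r)"
    using H pos \<rho> by (intro prob_chromatic_number_random_KG_less)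
  moreover have "measure_pmf.prob (random_KG r H \<rho>) {G. bound \<le> real (chromatic_number G)}
      = 1 - measure_pmf.prob (random_KG r H \<rho>) {G. real (chromatic_number G) < bound}"
    using measure_pmf.prob_neg[of "random_KG r H \<rho>" "\<lambda>G. real (chromatic_number G) < bound"]
    by (simp add: not_less)
  ultimately show ?thesis by (simp add: nats)
qed

theorem theorem1:
  fixes H :: "nat \<Rightarrow> 'a hypergraph"
    and n :: "nat \<Rightarrow> nat"
    and r :: "nat \<Rightarrow> nat"
    and t d q :: "nat \<Rightarrow> int"
    and \<rho> :: "nat \<Rightarrow> real"
  assumes "\<And>m. hypergraph (H m)"
    and "inj H"
    and "\<And>m. n m = card (verts (H m))"
    and "\<And>m. r (n m) \<ge> 2"
    and "\<And>m. q (n m) \<ge> 1"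
    and "\<And>m. (d (n m) - 1) * (t (n m) - 1) + 1 \<le> q (n m)"
    and "\<And>m. q (n m) \<le> (d (n m) - 1) * t (n m)"
    and "\<And>m. 0 < \<rho> (n m) \<and> \<rho> (n m) \<le> 1"
    and "filterlim
          (\<lambda>m. real (n m) * ln (real (r (n m)) + 1)
             + real (r (n m)) * real_of_int (t (n m)) * (1 + ln (real_of_int (d (n m)) - 1))
             - \<rho> (n m) * real_of_int (t (n m)) ^ r (n m))
          at_bot (filtercomap n at_top)"
  shows "((\<lambda>m. measure_pmf.prob (random_KG (r (n m)) (H m) (\<rho> (n m)))
            {G. real (chromatic_number G) \<ge>
                min ((real (card (verts (H m))) - real (alt_num (r (n m)) (H m) (q (n m))))
                       / (real (r (n m)) - 1))
                    (real_of_int (d (n m)))})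
          \<longlongrightarrow> 1) (filtercomap n at_top)"
    (is "(?prob \<longlongrightarrow> 1) ?F")
proof (rule tendsto_sandwich)
  let ?exponent = "\<lambda>m. real (n m) * ln (real (r (n m)) + 1)
      + real (r (n m)) * real_of_int (t (n m)) * (1 + ln (real_of_int (d (n m)) - 1))
      - \<rho> (n m) * real_of_int (t (n m)) ^ r (n m)"
  have "1 - exp (?exponent m) \<le> ?prob m" for m
    using prob_chromatic_number_random_KG_ge[OF assms(1,4,5,6,7)] assms(8)[of m]
    by (simp add: assms(3) less_imp_le)
  then show "\<forall>\<^sub>F m in ?F. 1 - exp (?exponent m) \<le> ?prob m" by simp
  have "((\<lambda>m. exp (?exponent m)) \<longlongrightarrow> 0) ?F"
    using exp_at_bot assms(9) by (rule filterlim_compose)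
  then show "((\<lambda>m. 1 - exp (?exponent m)) \<longlongrightarrow> 1) ?F"
    using tendsto_diff[OF tendsto_const] by fastforce
  show "\<forall>\<^sub>F m in ?F. ?prob m \<le> 1" by simp
qed (rule tendsto_const)

end
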